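(* Let $k$ and $\ell$ be odd positive integers, and put $q:=2^k$ and $Q:=2^\ell$. Let $a,b,c,d\in\mathbb{F}_{q^2}$ and write $A(X):=aX^{Q+1}+bX^Q+cX+d$. Then $f(X):=X^{Q+1}A(X^{q-1})$ permutes $\mathbb{F}_{q^2}$ if and only if all of the following hold: (1) $e:=a^{q+1}+b^{q+1}+c^{q+1}+d^{q+1}$ is nonzero; (2) $(a^qb+c^qd)^Q=e^{Q-1}(a^qc+b^qd)$; (3) $\mathrm{Tr}_{\mathbb{F}_q/\mathbb{F}_2}\Bigl(\frac{b^{q+1}+c^{q+1}}{e}\Bigr)=1$.
   Context: A polynomial permutes $\mathbb{F}_{q^2}$ if it induces a bijection of $\mathbb{F}_{q^2}$. $\mathrm{Tr}_{\mathbb{F}_q/\mathbb{F}_2}$ is the trace map; its argument lies in $\mathbb{F}_q$. *)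

theory Defs
  imports "HOL-Computational_Algebra.Computational_Algebra"
begin

text \<open>
  A polynomial over a finite field permutes the field if the polynomial function it induces
  is a bijection of the field.
\<close>

definition permutation_poly :: "'a :: finite_field poly \<Rightarrow> bool" where
  "permutation_poly p \<longleftrightarrow> bij (poly p)"

text \<open>
  The trace map from the field of order \<open>2 ^ k\<close> to the field of order 2, as the sum of the
  conjugates \<open>x ^ (2 ^ i)\<close>. Both fields are regarded as subfields of the ambient type, so the
  function is only meaningful at arguments with \<open>x ^ (2 ^ k) = x\<close>.
\<close>

definition trace_F2 :: "nat \<Rightarrow> 'a :: finite_field \<Rightarrow> 'a" where
  "trace_F2 k x = (\<Sum>i<k. x ^ (2 ^ i))"

end

theory Submission
  imports Defs "HOL-Analysis.Determinants" "HOL-Library.Nat_Bijection" "HOL-Number_Theory.Cong"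
begin

text \<open>
  Writing \<open>bar x = x ^ q\<close> and \<open>fr x = x ^ Q\<close>, the quadrinomial is the diagonal \<open>beta x x\<close> of a form that
  is \<open>fr\<close>-semilinear in its first and linear in its second argument over the field of order \<open>q\<close>.

  If \<open>e\<close> is nonzero and condition (2) holds, there is a linear operator \<open>P\<close> of trace 1 and determinant
  \<open>j\<close> equal to 0 or 1, with \<open>beta (P x) y = beta x (P y) + \<kappa> * beta x y\<close> where \<open>\<kappa>\<close> is 0 or 1; condition (3) says
  \<open>\<kappa> = 0\<close>. If \<open>\<kappa> = 1\<close> then \<open>beta (P x) (P x) = j * beta x x\<close>, which is incompatible with injectivity.
  If \<open>\<kappa> = 0\<close> then expanding \<open>x\<close> in terms of \<open>\<delta>\<close> and \<open>P \<delta>\<close> reduces a collision between \<open>x\<close> and \<open>x + \<delta>\<close> to the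
  equation \<open>t ^ Q + t = 1\<close>, which has no solution in the field of odd degree \<open>k\<close>.

  Conversely, suppose that the map is injective. If \<open>e\<close> vanished, some form \<open>\<theta> * beta x y + bar (\<theta> * beta x y)\<close>
  would vanish identically. For condition (2), the zeros of the diagonal of this form are the eigenvectors of a
  semilinear map \<open>\<Phi>\<close>; as there is just one eigenline, a suitable iterate of \<open>\<Phi>\<close> has trace zero.
  As a polynomial in \<open>\<theta>\<close> this trace has pairwise distinct exponents below the order of the field, so
  that all its coefficients vanish. These coefficients are traces of products of Frobenius conjugates of
  two fixed matrices, and their vanishing forces two explicit matrices to commute, which is condition (2).
\<close>

section \<open>Ordered matrix products, and sparse polynomials over a finite field\<close>

primrec matprod :: "(nat \<Rightarrow> 'a :: comm_semiring_1 ^ 'n ^ 'n) \<Rightarrow> nat \<Rightarrow> 'a ^ 'n ^ 'n" where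
  "matprod Y 0 = mat 1"
| "matprod Y (Suc n) = matprod Y n ** Y n"

definition smat :: "'a :: times \<Rightarrow> 'a ^ 'n ^ 'm \<Rightarrow> 'a ^ 'n ^ 'm" where
  "smat x M = map_matrix ((*) x) M"

lemma smat_nth [simp]: "smat x M $ i $ j = x * M $ i $ j"
  by (simp add: smat_def)

lemma smat_mult:
  fixes A :: "'a :: comm_semiring_1 ^ 'n ^ 'm"
  shows "smat x A ** smat y B = smat (x * y) (A ** B)"
  by (simp add: vec_eq_iff matrix_matrix_mult_def sum_distrib_left ac_simps)

lemma matrix_add_rdistrib: "(A + B) ** C = A ** C + B ** (C :: 'a :: semiring_1 ^ 'n ^ 'm)"
  by (simp add: vec_eq_iff matrix_matrix_mult_def distrib_right sum.distrib)

lemma matrix_mul_sum_left: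
  fixes B :: "'a :: semiring_1 ^ 'n ^ 'n"
  shows "(\<Sum>S\<in>X. W S) ** B = (\<Sum>S\<in>X. W S ** B)"
  by (induction X rule: infinite_finite_induct) (simp_all add: matrix_add_rdistrib)

lemma matprod_cong: "(\<And>i. i < n \<Longrightarrow> Y i = Z i) \<Longrightarrow> matprod Y n = matprod Z n"
  by (induction n) simp_all

lemma matprod_add: "matprod Y (m + n) = matprod Y m ** matprod (\<lambda>i. Y (m + i)) n"
  by (induction n) (simp_all add: matrix_mul_assoc)

lemma det_matprod:
  fixes Y :: "nat \<Rightarrow> 'a :: comm_ring_1 ^ 'n ^ 'n"
  shows "det (matprod Y n) = (\<Prod>i<n. det (Y i))"
  by (induction n) (simp_all add: det_mul)

text \<open>On distributing the product, \<open>S\<close> records the positions where the summand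
  with \<open>M\<close> is chosen.\<close>

lemma matprod_expand:
  fixes M N :: "nat \<Rightarrow> 'a :: comm_semiring_1 ^ 'n ^ 'n"
  shows "matprod (\<lambda>i. smat (x i) (M i) + smat (y i) (N i)) n =
    (\<Sum>S\<in>Pow {..<n}. smat (\<Prod>i<n. if i \<in> S then x i else y i)
       (matprod (\<lambda>i. if i \<in> S then M i else N i) n))"
proof (induction n)
  case 0
  show ?case by (simp add: vec_eq_iff)
next
  case (Suc n)
  define c where "c = (\<lambda>n S. \<Prod>i<n. if i \<in> S then x i else y i)"
  define W where "W = (\<lambda>n S. matprod (\<lambda>i. if i \<in> S then M i else N i) n)"
  have ins: "c (Suc n) (insert n S) = c n S * x n" "W (Suc n) (insert n S) = W n S ** M n"
    and nins: "c (Suc n) S = c n S * y n" "W (Suc n) S = W n S ** N n" if "S \<in> Pow {..<n}" for S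
  proof -
    have "n \<notin> S" using that by auto
    then show "c (Suc n) S = c n S * y n" "W (Suc n) S = W n S ** N n"
      by (simp_all add: c_def W_def)
    have "c n (insert n S) = c n S" "W n (insert n S) = W n S"
      unfolding c_def W_def by (auto intro!: prod.cong matprod_cong)
    then show "c (Suc n) (insert n S) = c n S * x n" "W (Suc n) (insert n S) = W n S ** M n"
      by (simp_all add: c_def W_def)
  qed
  have "matprod (\<lambda>i. smat (x i) (M i) + smat (y i) (N i)) (Suc n) =
      (\<Sum>S\<in>Pow {..<n}. smat (c n S) (W n S)) ** (smat (x n) (M n) + smat (y n) (N n))"
    using Suc by (simp add: c_def W_def)
  also have "\<dots> = (\<Sum>S\<in>Pow {..<n}. smat (c (Suc n) (insert n S)) (W (Suc n) (insert n S)))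
      + (\<Sum>S\<in>Pow {..<n}. smat (c (Suc n) S) (W (Suc n) S))"
    by (simp add: matrix_mul_sum_left matrix_add_ldistrib smat_mult ins nins sum.distrib)
  also have "(\<Sum>S\<in>Pow {..<n}. smat (c (Suc n) (insert n S)) (W (Suc n) (insert n S)))
      = (\<Sum>S\<in>insert n ` Pow {..<n}. smat (c (Suc n) S) (W (Suc n) S))"
    by (subst sum.reindex) (auto simp: inj_on_def)
  also have "\<dots> + (\<Sum>S\<in>Pow {..<n}. smat (c (Suc n) S) (W (Suc n) S))
      = (\<Sum>S\<in>Pow {..<Suc n}. smat (c (Suc n) S) (W (Suc n) S))"
    unfolding lessThan_Suc Pow_insert
    by (subst sum.union_disjoint) (auto simp: add.commute)
  finally show ?case by (simp only: c_def W_def)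
qed

lemma trace_sum: "trace (\<Sum>S\<in>X. W S) = (\<Sum>S\<in>X. trace (W S))"
  unfolding trace_def by (subst sum.swap) simp

lemma trace_smat: "trace (smat x M) = (x :: 'a :: comm_semiring_1) * trace M"
  by (simp add: trace_def sum_distrib_left)

lemma smat_mult_left:
  fixes A :: "'a :: comm_semiring_1 ^ 'n ^ 'm"
  shows "smat x A ** B = smat x (A ** B)" "A ** smat x B = smat x (A ** B)"
  by (simp_all add: vec_eq_iff matrix_matrix_mult_def sum_distrib_left ac_simps)

lemma trace_matprod_expand:
  fixes M N :: "nat \<Rightarrow> 'a :: comm_semiring_1 ^ 'n ^ 'n"
  shows "trace (matprod (\<lambda>i. smat (x i) (M i) + smat (y i) (N i)) n ** C) =
    (\<Sum>S\<in>Pow {..<n}. (\<Prod>i<n. if i \<in> S then x i else y i) *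
       trace (matprod (\<lambda>i. if i \<in> S then M i else N i) n ** C))"
  by (simp add: matprod_expand matrix_mul_sum_left trace_sum smat_mult_left trace_smat)

definition mat2 :: "'a :: zero \<Rightarrow> 'a \<Rightarrow> 'a \<Rightarrow> 'a \<Rightarrow> 'a ^ 2 ^ 2" where
  "mat2 p q r s = vector [vector [p, q], vector [r, s]]"

lemma mat2_nth [simp]:
  "mat2 p q r s $ 1 $ 1 = p" "mat2 p q r s $ 1 $ 2 = q"
  "mat2 p q r s $ 2 $ 1 = r" "mat2 p q r s $ 2 $ 2 = s"
  by (simp_all add: mat2_def)

lemmas entries2 = vec_eq_iff forall_2 matrix_matrix_mult_def sum_2 trace_def

text \<open>A polynomial of degree below the order of the field cannot vanish everywhere unless it
  is zero; distinct exponents then isolate each coefficient.\<close>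

lemma power_sum_eq_0_imp_coeffs:
  fixes c :: "'s \<Rightarrow> 'a :: finite_field"
  assumes "finite X" "inj_on t X" "\<And>s. s \<in> X \<Longrightarrow> t s < card (UNIV :: 'a set)"
    and zero: "\<And>x. (\<Sum>s\<in>X. x ^ t s * c s) = 0" and "s \<in> X"
  shows "c s = 0"
proof -
  define p where "p = (\<Sum>s\<in>X. monom (c s) (t s))"
  have roots: "poly p x = 0" for x
    using zero[of x] by (simp add: p_def poly_sum poly_monom mult.commute)
  have "degree p < card (UNIV :: 'a set)"
    unfolding p_def using assms(1,3) finite_UNIV_card_ge_0[where 'a = 'a]
    by (intro degree_sum_less) (auto intro: le_less_trans[OF degree_monom_le])
  then have "p = 0"
    using card_poly_roots_bound[of p] roots by (cases "p = 0") auto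
  then have "0 = coeff p (t s)" by simp
  also have "\<dots> = (\<Sum>s'\<in>X. if s' = s then c s' else 0)"
    unfolding p_def coeff_sum using assms(2,5) by (intro sum.cong) (auto simp: coeff_monom inj_on_def)
  also have "\<dots> = c s" using assms(1,5) by simp
  finally show ?thesis by simp
qed

section \<open>The field with q^2 elements: characteristic 2 and Frobenius maps\<close>

locale even_ext_field =
  fixes k l :: nat and F :: "'a :: finite_field itself"
  assumes odd_k: "odd k" and odd_l: "odd l"
    and card_F: "card (UNIV :: 'a set) = (2 ^ k)\<^sup>2"
begin

definition bar :: "'a \<Rightarrow> 'a" where "bar x = x ^ (2 ^ k)"

definition fr :: "'a \<Rightarrow> 'a" where "fr x = x ^ (2 ^ l)"

lemma card_F': "card (UNIV :: 'a set) = 2 ^ (2 * k)"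
  using card_F by (simp add: power_mult[symmetric] mult.commute)

lemma k_pos: "k > 0" using odd_k by (rule odd_pos)

lemma char_F: "CHAR('a) = 2"
proof -
  \<comment> \<open>Translation by 1 permutes the field, so the number of its elements is zero in
    it.\<close>
  have "(\<Sum>x\<in>UNIV. x :: 'a) = (\<Sum>x\<in>UNIV. x + 1)"
    by (rule sum.reindex_bij_witness[of _ "\<lambda>x. x + 1" "\<lambda>x. x - 1"]) auto
  then have "(of_nat (card (UNIV :: 'a set)) :: 'a) = 0"
    by (simp add: sum.distrib)
  then have "CHAR('a) dvd 2 ^ (2 * k)"
    using card_F' of_nat_eq_0_iff_char_dvd by metis
  moreover have "prime CHAR('a)" by simp
  ultimately show ?thesis
    by (metis prime_dvd_power_nat primes_dvd_imp_eq two_is_prime_nat)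
qed

lemma two_eq_0 [simp]: "(2 :: 'a) = 0"
  using of_nat_CHAR[where 'a = 'a] char_F by simp

lemma double [simp]: "x + x = (0 :: 'a)"
  by (simp flip: mult_2)

lemma double_left [simp]: "x + (x + y) = (y :: 'a)"
  by (simp flip: add.assoc)

lemma eq_iff_add: "x = y \<longleftrightarrow> x + y = (0 :: 'a)"
  by (metis add_right_imp_eq double)

lemma eq_addI: "x + y = 0 \<Longrightarrow> x = (y :: 'a)"
  using eq_iff_add by blast

lemma minus_F [simp]: "- x = (x :: 'a)" "x - y = x + (y :: 'a)"
  by (rule minus_unique, simp) (simp add: diff_eq_eq add.assoc)

lemma add_power_2_power: "(x + y :: 'a) ^ (2 ^ m) = x ^ (2 ^ m) + y ^ (2 ^ m)"
  by (rule freshmans_dream') (simp_all add: char_F)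

lemma bar_simps [simp]:
  "bar (x + y) = bar x + bar y" "bar (x * y) = bar x * bar y" "bar (x / y) = bar x / bar y"
  "bar 0 = 0" "bar 1 = 1" "bar (x ^ n) = bar x ^ n" "bar (bar x) = x"
proof -
  show "bar (bar x) = x"
    using finite_field_power_card_eq_same[of x] card_F
    by (simp add: bar_def power2_eq_square power_mult)
qed (simp_all add: bar_def add_power_2_power power_mult_distrib power_divide power_0_left
       flip: power_mult, simp_all add: mult.commute)

lemma fr_simps [simp]:
  "fr (x + y) = fr x + fr y" "fr (x * y) = fr x * fr y" "fr (x / y) = fr x / fr y"
  "fr 0 = 0" "fr 1 = 1" "fr (x ^ n) = fr x ^ n" "fr (bar x) = bar (fr x)"
  by (simp_all add: fr_def bar_def add_power_2_power power_mult_distrib power_divide power_0_left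
       flip: power_mult, simp_all add: mult.commute)

lemma fr_sum [simp]: "fr (sum g A) = (\<Sum>i\<in>A. fr (g i))"
  by (induction A rule: infinite_finite_induct) simp_all

lemma bar_eq_0 [simp]: "bar x = 0 \<longleftrightarrow> x = 0"
  by (simp add: bar_def)

lemma fr_eq_0 [simp]: "fr x = 0 \<longleftrightarrow> x = 0"
  by (simp add: fr_def)

lemma bij_power_2_power: "bij (\<lambda>x :: 'a. x ^ (2 ^ m))"
proof -
  have "inj (\<lambda>x :: 'a. x ^ (2 ^ m))"
  proof (rule injI)
    fix x y :: 'a assume "x ^ (2 ^ m) = y ^ (2 ^ m)"
    then have "(x + y) ^ (2 ^ m) = 0"
      by (simp add: add_power_2_power)
    then show "x = y" by (simp flip: eq_iff_add)
  qed
  then show ?thesis by (simp add: bij_def finite_UNIV_inj_surj)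
qed

lemma fr_eq_iff [simp]: "fr x = fr y \<longleftrightarrow> x = y"
  using bij_power_2_power[of l] unfolding fr_def bij_def inj_def by blast

lemma funpow_fr: "(fr ^^ j) x = x ^ (2 ^ (l * j))"
  by (induction j) (simp_all add: fr_def power_add mult.commute flip: power_mult)

lemma power_bar_odd: "odd m \<Longrightarrow> x ^ (2 ^ (k * m)) = bar x"
proof -
  have *: "(bar ^^ m) x = x ^ (2 ^ (k * m))" for m
    by (induction m) (simp_all add: bar_def power_add mult.commute flip: power_mult)
  have "(bar ^^ (2 * j)) x = x" for j
    by (induction j) simp_all
  then have "(bar ^^ (2 * j + 1)) x = bar x" for j
    by simp
  then show "odd m \<Longrightarrow> x ^ (2 ^ (k * m)) = bar x"
    using * by (metis oddE)
qed

lemma funpow_fr_odd_multiple: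
  assumes "l * j = k * m" "odd m"
  shows "(fr ^^ j) x = bar x"
  using assms by (simp add: funpow_fr power_bar_odd)

lemma funpow_fr_k: "(fr ^^ k) x = bar x"
  by (rule funpow_fr_odd_multiple[of _ l]) (simp_all add: odd_l)

section \<open>Artin-Schreier equations, powers in the subfield, and traces\<close>

lemma artin_schreier_ne_one:
  assumes "bar t = t"
  shows "fr t + t \<noteq> 1"
proof
  assume *: "fr t + t = 1"
  then have ft: "fr t = t + 1" by (metis add.commute double_left)
  have "(fr ^^ (2 * j)) t = t" for j
    by (induction j) (simp_all add: ft)
  \<comment> \<open>An odd number of steps adds 1, yet \<open>fr ^^ k\<close> is \<open>bar\<close>,
    which fixes \<open>t\<close>.\<close>
  then have "(fr ^^ (2 * j + 1)) t = t + 1" for j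
    by (simp add: ft)
  then have "(fr ^^ k) t = t + 1" using odd_k by (metis oddE)
  with funpow_fr_k assms have "t + 1 = t" by simp
  then show False by simp
qed

text \<open>Such a \<open>t\<close> generates GF(4), where an odd power of the Frobenius map acts as
  squaring.\<close>

lemma fr_eq_add_one:
  assumes "t\<^sup>2 + t = (1 :: 'a)"
  shows "fr t = t + 1"
proof -
  have sq: "t\<^sup>2 = t + 1" using assms by (metis add.commute double_left)
  then have "t ^ 4 = t" by (simp add: power4_eq_xxxx power2_eq_square algebra_simps)
  have "t ^ (2 ^ (2 * j)) = t" for j
  proof (induction j)
    case (Suc j)
    have "t ^ (2 ^ (2 * Suc j)) = (t ^ (2 ^ (2 * j))) ^ 4"
      by (simp add: mult.commute flip: power_mult)
    then show ?case using Suc \<open>t ^ 4 = t\<close> by simp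
  qed simp
  then have "t ^ (2 ^ (2 * j + 1)) = t + 1" for j
    using sq by (metis power_add power_mult power_one_right)
  then show ?thesis using odd_l unfolding fr_def by (metis oddE)
qed

lemma square_add_ne_one:
  assumes "bar t = t"
  shows "t\<^sup>2 + t \<noteq> 1"
proof
  assume "t\<^sup>2 + t = 1"
  then have "fr t + t = 1" by (simp add: fr_eq_add_one add.commute)
  then show False using artin_schreier_ne_one[OF assms] by simp
qed

text \<open>Since \<open>k\<close> and \<open>l\<close> are odd, \<open>2 ^ l + 1\<close> is coprime to \<open>2 ^ k - 1\<close>.\<close>

lemma subfield_power_surj:
  assumes "bar m = m"
  obtains r where "bar r = r" "fr r * r = m"
proof -
  define S where "S = {x :: 'a. bar x = x}"
  have "inj_on (\<lambda>r. fr r * r) S"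
  proof (rule inj_onI)
    fix x y assume xy: "x \<in> S" "y \<in> S" "fr x * x = fr y * y"
    show "x = y"
    proof (cases "y = 0")
      case True
      then show ?thesis using xy by simp
    next
      case False
      define z where "z = x / y"
      have z: "fr z * z = 1" "bar z = z" "z \<noteq> 0"
        using xy False by (auto simp: z_def S_def)
      \<comment> \<open>An odd iterate of \<open>fr\<close> inverts \<open>z\<close>, while
        \<open>fr ^^ k\<close> fixes it; hence \<open>z * z = 1\<close>.\<close>
      have fz: "fr z = inverse z" using z by (metis inverse_unique mult.commute)
      have finv: "fr (inverse z) = z"
        using fz by (metis fr_simps(3,5) inverse_eq_divide inverse_inverse_eq)
      have "(fr ^^ (2 * j)) z = z" for j
        by (induction j) (simp_all add: fz finv)
      then have "(fr ^^ (2 * j + 1)) z = inverse z" for j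
        by (simp add: fz)
      then have "(fr ^^ k) z = inverse z" using odd_k by (metis oddE)
      then have "inverse z = z" using z funpow_fr_k by simp
      then have "z * z = 1" using z by (metis left_inverse)
      then have "(z + 1) * (z + 1) = 0"
        by (simp add: algebra_simps)
      then have "z = 1" by (simp flip: eq_iff_add)
      then show ?thesis using False by (simp add: z_def)
    qed
  qed
  moreover have "(\<lambda>r. fr r * r) ` S \<subseteq> S"
    by (auto simp: S_def simp flip: fr_simps(7))
  ultimately have "(\<lambda>r. fr r * r) ` S = S"
    by (meson endo_inj_surj finite)
  then show ?thesis using that assms unfolding S_def by (smt (verit) imageE mem_Collect_eq)
qed

lemma trace_F2_add: "trace_F2 k (x + y :: 'a) = trace_F2 k x + trace_F2 k y"
  unfolding trace_F2_def add_power_2_power sum.distrib by (rule refl)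

lemma trace_F2_one: "trace_F2 k (1 :: 'a) = 1"
proof -
  have "(of_nat (2 * j + 1) :: 'a) = 1" for j
    by (induction j) (simp_all add: algebra_simps)
  moreover obtain j where "k = 2 * j + 1" using odd_k by (rule oddE)
  ultimately have "(of_nat k :: 'a) = 1" by metis
  then show ?thesis by (simp add: trace_F2_def)
qed

lemma sum_conjugates_square_add: "(\<Sum>i<n. (z\<^sup>2 + z) ^ (2 ^ i)) = z ^ (2 ^ n) + (z :: 'a)"
  by (induction n) (simp_all add: add_power_2_power add_ac flip: power_mult)

lemma trace_F2_square_add: "trace_F2 k (z\<^sup>2 + z :: 'a) = bar z + z"
  by (simp add: trace_F2_def bar_def sum_conjugates_square_add)

text \<open>Additive Hilbert 90, by counting: the polynomial \<open>\<Sum>i<2k. X ^ (2 ^ i)\<close> has at most as many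
  roots as there are values of \<open>z\<^sup>2 + z\<close>.\<close>

lemma artin_schreier_root:
  assumes "bar c = c"
  obtains z where "z\<^sup>2 + z = c"
proof -
  define T where "T = (\<lambda>x :: 'a. \<Sum>i<2*k. x ^ (2 ^ i))"
  define I where "I = range (\<lambda>z :: 'a. z\<^sup>2 + z)"
  have sq: "(\<lambda>z :: 'a. z\<^sup>2 + z) -` {(\<lambda>z. z\<^sup>2 + z) z} = {z, z + 1}" for z
  proof -
    have "y\<^sup>2 + y = z\<^sup>2 + z \<longleftrightarrow> (y + z) * (y + (z + 1)) = 0" for y
      using eq_iff_add[of "y\<^sup>2 + y" "z\<^sup>2 + z"] by (simp add: power2_eq_square algebra_simps)
    then show ?thesis by (auto simp flip: eq_iff_add)
  qed
  have "card (UNIV :: 'a set) = (\<Sum>y\<in>I. card ((\<lambda>z. z\<^sup>2 + z) -` {y}))"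
    unfolding I_def by (subst card_eq_sum, subst sum.group[symmetric, of UNIV "range (\<lambda>z :: 'a. z\<^sup>2 + z)" "\<lambda>z. z\<^sup>2 + z"])
      (auto simp: vimage_def)
  also have "\<dots> = (\<Sum>y\<in>I. 2)"
    by (rule sum.cong) (auto simp: I_def sq[simplified])
  finally have "2 * card I = 2 * 2 ^ (2 * k - 1)"
    using card_F' k_pos by (simp flip: power_Suc)
  then have card_I: "card I = 2 ^ (2 * k - 1)" by simp
  define P :: "'a poly" where "P = (\<Sum>i<2*k. monom 1 (2 ^ i))"
  have PT: "poly P x = T x" for x
    by (simp add: P_def T_def poly_sum poly_monom)
  have deg: "degree P \<le> 2 ^ (2 * k - 1)"
    unfolding P_def by (intro degree_sum_le) (auto intro!: order_trans[OF degree_monom_le])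
  have "coeff P 1 = 1"
  proof -
    have "coeff P 1 = (\<Sum>i<2*k. if i = 0 then 1 else 0)"
      unfolding P_def coeff_sum by (intro sum.cong) (auto simp: coeff_monom)
    then show ?thesis using k_pos by simp
  qed
  then have "P \<noteq> 0" by auto
  have "I \<subseteq> {x. T x = 0}"
    using finite_field_power_card_eq_same[where 'a = 'a] card_F'
    by (auto simp: I_def T_def sum_conjugates_square_add)
  moreover have "card {x. T x = 0} \<le> card I"
    using card_poly_roots_bound[OF \<open>P \<noteq> 0\<close>] deg by (simp add: PT card_I)
  ultimately have "I = {x. T x = 0}" by (simp add: card_seteq)
  moreover have "T c = 0"
  proof -
    have "(\<Sum>i<k+n. c ^ (2 ^ i)) = (\<Sum>i<k. c ^ (2 ^ i)) + (\<Sum>i<n. bar c ^ (2 ^ i))" for n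
      by (induction n) (simp_all add: bar_def power_add ac_simps flip: power_mult)
    from this[of k] show ?thesis using assms by (simp add: T_def mult_2)
  qed
  ultimately have "c \<in> I" by simp
  then show ?thesis using that by (auto simp: I_def)
qed

text \<open>The constant \<open>j\<close> only repairs the trace condition for solvability of \<open>p\<^sup>2 + p = V\<close>.\<close>

lemma artin_schreier_conj_pair:
  assumes "bar V = V"
  obtains p j where "p\<^sup>2 + p = V + j" "p + bar p = 1" "j = 0 \<or> j = (1 :: 'a)"
proof -
  obtain z where z: "z\<^sup>2 + z = V" using artin_schreier_root[OF assms] by blast
  have zz: "bar z + z = trace_F2 k V" using trace_F2_square_add[of z] z by simp
  have "(z + bar z)\<^sup>2 + (z + bar z) = (z\<^sup>2 + z) + bar (z\<^sup>2 + z)"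
    by (simp add: power2_eq_square algebra_simps)
  also have "\<dots> = 0" using z assms by simp
  finally have "(z + bar z) * (z + bar z + 1) = 0" by (simp add: power2_eq_square algebra_simps)
  then consider "z + bar z = 1" | "z + bar z = 0" using eq_iff_add[of "z + bar z" 1] by auto
  then show ?thesis
  proof cases
    case 1
    then show ?thesis using that[of z 0] z by simp
  next
    case 2
    have "bar (V + 1) = V + 1" using assms by simp
    then obtain y where y: "y\<^sup>2 + y = V + 1" using artin_schreier_root by blast
    have "y + bar y = trace_F2 k (V + 1)"
      using trace_F2_square_add[of y] y by (simp add: add.commute)
    also have "\<dots> = 1" using 2 zz by (simp add: trace_F2_add trace_F2_one add.commute)
    finally show ?thesis using that[of y 1] y by simp
  qed
qed

text \<open>As \<open>p\<close> is not fixed by \<open>bar\<close>, the sum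
  \<open>S = trace_F2 k p\<close> lies outside GF(2): it satisfies \<open>S\<^sup>2 + S = 1\<close>,
  so \<open>fr\<close> adds 1 to it.\<close>

lemma trace_F2_add_fr:
  assumes "p + bar p = 1"
  shows "trace_F2 k (p + fr p) = 1"
proof -
  define S where "S = trace_F2 k p"
  have "S\<^sup>2 + S = trace_F2 k (p\<^sup>2 + p)"
  proof -
    have "S\<^sup>2 = (\<Sum>i<k. (p ^ (2 ^ i))\<^sup>2)"
      unfolding S_def trace_F2_def by (rule freshmans_dream_sum) (simp_all add: char_F)
    also have "\<dots> = trace_F2 k (p\<^sup>2)"
      by (simp add: trace_F2_def mult.commute flip: power_mult)
    finally show ?thesis by (simp add: trace_F2_add S_def)
  qed
  then have SS: "S\<^sup>2 + S = 1" using trace_F2_square_add[of p] assms by (simp add: add.commute)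
  then have "fr S = S + 1" by (rule fr_eq_add_one)
  moreover have "trace_F2 k (fr p) = fr S"
    by (simp add: S_def trace_F2_def)
  ultimately show ?thesis by (simp add: trace_F2_add S_def add.commute)
qed

end

section \<open>The field as a plane over its subfield\<close>

context even_ext_field
begin

text \<open>The determinant of \<open>x\<close> and \<open>y\<close> with respect to the coordinates \<open>(bar x, x)\<close>; it vanishes
  iff \<open>x\<close> and \<open>y\<close> are linearly dependent over the subfield fixed by \<open>bar\<close>.\<close>

definition dt :: "'a \<Rightarrow> 'a \<Rightarrow> 'a" where "dt x y = x * bar y + bar x * y"

lemma bar_dt [simp]: "bar (dt x y) = dt x y"
  by (simp add: dt_def add.commute)

lemma dt_simps [simp]:
  "dt (x + y) z = dt x z + dt y z" "dt z (x + y) = dt z x + dt z y" "dt x x = 0"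
  by (simp_all add: dt_def algebra_simps)

lemma dt_scale:
  assumes "bar r = r"
  shows "dt (r * x) y = r * dt x y" "dt x (r * y) = r * dt x y"
  using assms by (simp_all add: dt_def algebra_simps)

lemma dt_eq_0E:
  assumes "dt x y = 0" "x \<noteq> 0"
  obtains r where "bar r = r" "y = r * x"
proof
  show "y = y / x * x" using assms by simp
  have "x * bar y = y * bar x"
    using assms(1) unfolding dt_def by (simp add: mult.commute flip: eq_iff_add)
  then show "bar (y / x) = y / x"
    using assms(2) by (simp add: frac_eq_eq mult.commute)
qed

lemma dt_cramer: "dt x g * \<delta> + dt \<delta> x * g = dt \<delta> g * x"
  by (simp add: dt_def algebra_simps)

lemma subfield_frI: "bar (fr r) = fr r \<Longrightarrow> bar r = r"
  by (metis fr_eq_iff fr_simps(7))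

lemma fr_surj: obtains y where "fr y = x"
proof -
  from bij_is_surj[OF bij_power_2_power] obtain y where "x = y ^ (2 ^ l)" by (rule surjE)
  then show ?thesis using that by (simp add: fr_def)
qed

lemma trace_one_elem: obtains p where "p + bar p = 1"
  using artin_schreier_conj_pair[of 0] by (metis bar_simps(4))

lemma dt_eq_one:
  assumes "x \<noteq> 0"
  obtains y where "dt x y = 1"
proof -
  obtain p where "p + bar p = 1" by (rule trace_one_elem)
  then have "dt x (p / bar x) = 1"
    using assms by (simp add: dt_def add.commute)
  then show ?thesis by (rule that)
qed

lemma bar_linear_eq_0:
  assumes "\<And>x. \<alpha> * bar x + \<gamma> * x = 0"
  shows "\<alpha> = 0" "\<gamma> = 0"
proof -
  obtain p where p: "p + bar p = 1" by (rule trace_one_elem)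
  then have bp: "bar p = p + 1" by (metis double_left)
  have "\<alpha> + \<gamma> = 0" using assms[of 1] by simp
  then have "\<gamma> = \<alpha>" using eq_iff_add by metis
  moreover have "\<alpha> * bar p + \<gamma> * p = 0" by (rule assms)
  ultimately show "\<alpha> = 0" using bp by (simp add: algebra_simps)
  then show "\<gamma> = 0" using \<open>\<gamma> = \<alpha>\<close> by simp
qed

end

section \<open>The semilinear form of the quadrinomial and its invariants\<close>

locale quadrinomial = even_ext_field k l F for k l and F :: "'a :: finite_field itself" +
  fixes a b c d :: 'a
begin

text \<open>The quadrinomial is \<open>x \<mapsto> beta x x\<close>; the form \<open>beta\<close> is additive in both arguments,
  \<open>fr\<close>-semilinear in the first and linear in the second over the subfield fixed by \<open>bar\<close>.\<close>

definition beta :: "'a \<Rightarrow> 'a \<Rightarrow> 'a" where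
  "beta x y = a * bar (fr x) * bar y + b * bar (fr x) * y + c * fr x * bar y + d * fr x * y"

text \<open>For nonzero \<open>e\<close>, condition (2) is equivalent to
  \<open>e * fr v = fr e * w\<close>.\<close>

definition e :: 'a where "e = a * bar a + b * bar b + c * bar c + d * bar d"
definition v :: 'a where "v = bar a * b + bar c * d"
definition w :: 'a where "w = bar a * c + bar b * d"
definition \<tau> :: 'a where "\<tau> = (b * bar b + c * bar c) / e"

text \<open>Over the subfield, \<open>E1 x\<close> is the determinant of the map sending
  \<open>fr y\<close> to \<open>beta y x\<close>, and \<open>E2 x\<close> that of
  \<open>beta x\<close>.\<close>

definition E1 :: "'a \<Rightarrow> 'a" where
  "E1 x = bar v * (bar x)\<^sup>2 + e * (x * bar x) + v * x\<^sup>2"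

definition E2 :: "'a \<Rightarrow> 'a" where
  "E2 x = bar w * (bar (fr x))\<^sup>2 + e * (fr x * bar (fr x)) + w * (fr x)\<^sup>2"

lemma bar_e [simp]: "bar e = e"
  by (simp add: e_def algebra_simps)

lemma bar_E1 [simp]: "bar (E1 x) = E1 x"
  by (simp add: E1_def algebra_simps)

lemma bar_E2 [simp]: "bar (E2 x) = E2 x"
  by (simp add: E2_def algebra_simps)

lemma bar_tau [simp]: "bar \<tau> = \<tau>"
  by (simp add: \<tau>_def algebra_simps)

lemma beta_add [simp]:
  "beta (x + y) z = beta x z + beta y z" "beta z (x + y) = beta z x + beta z y"
  by (simp_all add: beta_def algebra_simps)

lemma beta_0 [simp]: "beta 0 y = 0" "beta x 0 = 0"
  by (simp_all add: beta_def)

lemma beta_scale: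
  assumes "bar r = r"
  shows "beta (r * x) y = fr r * beta x y" "beta x (r * y) = r * beta x y"
proof -
  have "bar (fr r) = fr r" using assms fr_simps(7) by metis
  then show "beta (r * x) y = fr r * beta x y" "beta x (r * y) = r * beta x y"
    using assms by (simp_all add: beta_def algebra_simps)
qed

lemma dt_beta_left: "dt (beta x x) (beta x y) = dt x y * E2 x"
  by (simp add: dt_def beta_def E2_def e_def w_def power2_eq_square algebra_simps)

lemma dt_beta_right: "dt (beta x x) (beta y x) = fr (dt x y) * E1 x"
  by (simp add: dt_def beta_def E1_def e_def v_def power2_eq_square algebra_simps)

text \<open>For nonzero \<open>e\<close> this says that the norms of \<open>v / e\<close> and
  \<open>w / e\<close> add up to \<open>\<tau>\<^sup>2 + \<tau>\<close>, which links condition (2)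
  to condition (3).\<close>

lemma norm_v_add_norm_w:
  "v * bar v + w * bar w = (b * bar b + c * bar c) * (b * bar b + c * bar c + e)"
  by (simp add: e_def v_def w_def algebra_simps)

end

text \<open>The operator \<open>P\<close> is linear over the subfield fixed by \<open>bar\<close> with characteristic polynomial
  \<open>X\<^sup>2 + X + j\<close>; it is self-adjoint for \<open>beta\<close> if \<open>\<kappa> = 0\<close>.\<close>

locale twisted_quadrinomial = quadrinomial k l F a b c d
  for k l and F :: "'a :: finite_field itself" and a b c d :: 'a +
  fixes P :: "'a \<Rightarrow> 'a" and j \<kappa> :: 'a
  assumes P_scale: "bar r = r \<Longrightarrow> P (r * x) = r * P x"
    and P_P: "P (P x) = P x + j * x" and dt_P: "dt (P x) y + dt x (P y) = dt x y"
    and dt_P_self: "dt x (P x) = E1 x / e" and beta_P: "beta (P x) y = beta x (P y) + \<kappa> * beta x y"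
    and j: "j = 0 \<or> j = 1" and \<kappa>: "\<kappa> = 0 \<or> \<kappa> = 1"
    and trace_\<tau>: "trace_F2 k \<tau> = 1 \<longleftrightarrow> \<kappa> = 0"

section \<open>The twisting operator and sufficiency of the conditions\<close>

context quadrinomial
begin

lemma twist_exists:
  assumes e: "e \<noteq> 0" and v: "e * fr v = fr e * w"
  obtains P j \<kappa> where "twisted_quadrinomial k l a b c d P j \<kappa>"
proof -
  define n where "n = v / e"
  define m where "m = w / e"
  have vn: "v = e * n" and wm: "w = e * m" using e by (simp_all add: n_def m_def)
  have bvn: "bar v = e * bar n" and bwm: "bar w = e * bar m" by (simp_all add: vn wm)
  have m: "m = fr n"
    using e v by (simp add: n_def m_def field_simps)
  have bc: "b * bar b + c * bar c = e * \<tau>" using e by (simp add: \<tau>_def)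
  have "e * e * (n * bar n + m * bar m) = e * e * (\<tau>\<^sup>2 + \<tau>)"
    using norm_v_add_norm_w unfolding bc by (simp add: vn wm power2_eq_square algebra_simps)
  then have nm: "n * bar n + m * bar m = \<tau>\<^sup>2 + \<tau>" using e by simp
  have "bar (n * bar n) = n * bar n" by (simp add: mult.commute)
  then obtain p j where p: "p\<^sup>2 + p = n * bar n + j" "p + bar p = 1" and j: "j = 0 \<or> j = 1"
    by (rule artin_schreier_conj_pair)
  have bp: "bar p = p + 1" using p by (metis double_left)
  \<comment> \<open>Applying \<open>\<lambda>z. z\<^sup>2 + z\<close> to the three summands gives
    \<open>n * bar n + j\<close>, \<open>m * bar m + j\<close> and the sum of the two norms, so
    \<open>\<kappa>\<close> is 0 or 1.\<close>
  define \<kappa> where "\<kappa> = p + fr p + \<tau>"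
  have fp: "fr p = p + \<tau> + \<kappa>" by (simp add: \<kappa>_def add_ac)
  have frj: "fr j = j" using j by auto
  have "\<kappa>\<^sup>2 + \<kappa> = (p\<^sup>2 + p) + fr (p\<^sup>2 + p) + (\<tau>\<^sup>2 + \<tau>)"
    by (simp add: \<kappa>_def power2_eq_square algebra_simps)
  also have "\<dots> = 0"
    unfolding p(1) nm[symmetric] by (simp add: frj m add_ac)
  finally have "\<kappa> * (\<kappa> + 1) = 0" by (simp add: power2_eq_square algebra_simps)
  then have \<kappa>: "\<kappa> = 0 \<or> \<kappa> = 1" using eq_iff_add[of \<kappa> 1] by auto
  have "trace_F2 k (p + fr p) = 1" using p(2) by (rule trace_F2_add_fr)
  moreover have "p + fr p = \<tau> + \<kappa>" by (simp add: fp add_ac)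
  moreover have "trace_F2 k \<kappa> = \<kappa>"
    using \<kappa> trace_F2_one by (auto simp: trace_F2_def power_0_left)
  ultimately have "trace_F2 k \<tau> + \<kappa> = 1" by (simp add: trace_F2_add)
  then have tr: "trace_F2 k \<tau> = 1 \<longleftrightarrow> \<kappa> = 0"
    using \<kappa> by auto
  \<comment> \<open>\<open>r1\<close> to \<open>r4\<close> say that the four coefficients of
    \<open>beta (P x) y + beta x (P y) + \<kappa> * beta x y\<close> vanish.\<close>
  have "e * (a * \<tau>) = a * (b * bar b + c * bar c)"
    unfolding bc by (simp add: algebra_simps)
  also have "\<dots> = b * bar v + c * bar w"
    by (simp add: v_def w_def e_def algebra_simps)
  also have "\<dots> = e * (b * bar n + c * bar m)"
    unfolding vn wm bvn bwm by (simp add: algebra_simps)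
  finally have r1: "a * \<tau> + b * bar n + c * bar m = 0"
    using e by (simp add: add.assoc)
  have "e * (b * (1 + \<tau>)) = b * (e + (b * bar b + c * bar c))"
    unfolding bc by (simp add: algebra_simps)
  also have "\<dots> = d * bar w + a * v"
    by (simp add: v_def w_def e_def algebra_simps)
  also have "\<dots> = e * (d * bar m + a * n)"
    unfolding vn wm bvn bwm by (simp add: algebra_simps)
  finally have r2: "b * (1 + \<tau>) + d * bar m + a * n = 0"
    using e by (simp add: add.assoc)
  have "e * (c * (1 + \<tau>)) = c * (e + (b * bar b + c * bar c))"
    unfolding bc by (simp add: algebra_simps)
  also have "\<dots> = d * bar v + a * w"
    by (simp add: v_def w_def e_def algebra_simps)
  also have "\<dots> = e * (d * bar n + a * m)"
    unfolding vn wm bvn bwm by (simp add: algebra_simps)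
  finally have r3: "c * (1 + \<tau>) + d * bar n + a * m = 0"
    using e by (simp add: add.assoc)
  have "e * (d * \<tau>) = d * (b * bar b + c * bar c)"
    unfolding bc by (simp add: algebra_simps)
  also have "\<dots> = c * v + b * w"
    by (simp add: v_def w_def e_def algebra_simps)
  also have "\<dots> = e * (c * n + b * m)"
    unfolding vn wm bvn bwm by (simp add: algebra_simps)
  finally have r4: "d * \<tau> + c * n + b * m = 0"
    using e by (simp add: add.assoc)
  have bk: "bar \<kappa> = \<kappa>" using \<kappa> by auto
  \<comment> \<open>The trace is \<open>p + bar p = 1\<close> and the determinant
    \<open>p * bar p + n * bar n = j\<close>; the coefficient \<open>bar n\<close> is chosen to make
    \<open>dt x (P x)\<close> equal to \<open>E1 x / e\<close>.\<close>
  define P where "P = (\<lambda>x. bar p * x + bar n * bar x)"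
  have bfp: "bar (fr p) = p + \<tau> + \<kappa> + 1"
    using bp fp by (metis fr_simps(1,5,7) )
  show ?thesis
  proof (rule that[of P j \<kappa>], unfold_locales)
    fix x y
    have "beta (P x) y + beta x (P y) + \<kappa> * beta x y =
        (a * \<tau> + b * bar n + c * bar m) * (bar (fr x) * bar y)
      + (b * (1 + \<tau>) + d * bar m + a * n) * (bar (fr x) * y)
      + (c * (1 + \<tau>) + d * bar n + a * m) * (fr x * bar y)
      + (d * \<tau> + c * n + b * m) * (fr x * y)"
      by (simp add: beta_def P_def m bfp fp bp bk algebra_simps)
    then have "beta (P x) y + (beta x (P y) + \<kappa> * beta x y) = 0"
      unfolding r1 r2 r3 r4 by (simp add: add.assoc)
    then show "beta (P x) y = beta x (P y) + \<kappa> * beta x y" using eq_iff_add by blast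
    have "P (P x) = (bar (p\<^sup>2) + n * bar n) * x + bar n * (p + bar p) * bar x"
      by (simp add: P_def power2_eq_square algebra_simps)
    also have "bar (p\<^sup>2) + n * bar n = bar p + j"
    proof -
      have h: "bar (p\<^sup>2 + p) = n * bar n + j" using p j by auto
      have "bar (p\<^sup>2) + n * bar n + (bar p + j) = bar (p\<^sup>2 + p) + (n * bar n + j)"
        by (simp add: add_ac)
      also have "\<dots> = 0" unfolding h by (rule double)
      finally show ?thesis using eq_iff_add by blast
    qed
    finally show "P (P x) = P x + j * x"
      using p(2) by (simp add: P_def algebra_simps)
    have "dt (P x) y + dt x (P y) = (p + bar p) * dt x y"
      by (simp add: P_def dt_def algebra_simps)
    then show "dt (P x) y + dt x (P y) = dt x y" by (simp add: p(2))
    have "dt x (P x) = bar n * (bar x)\<^sup>2 + (p + bar p) * (x * bar x) + n * x\<^sup>2"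
      by (simp add: P_def dt_def power2_eq_square algebra_simps)
    then show "dt x (P x) = E1 x / e" unfolding p(2)
      using e by (simp add: E1_def n_def add_divide_distrib)
  qed (use j \<kappa> tr in \<open>simp_all add: P_def algebra_simps\<close>)
qed

text \<open>Through this, for nonzero \<open>e\<close>, the determinants \<open>E1 x\<close> and
  \<open>E2 x\<close> vanish together.\<close>

lemma fr_E1:
  assumes "e * fr v = fr e * w"
  shows "e * fr (E1 x) = fr e * E2 x"
proof -
  have "e * bar (fr v) = fr e * bar w"
    using arg_cong[OF assms, of bar] by (simp flip: fr_simps(7))
  have "e * fr (E1 x) = (e * bar (fr v)) * (bar (fr x))\<^sup>2 + e * (fr e * (fr x * bar (fr x))) + (e * fr v) * (fr x)\<^sup>2"
    by (simp add: E1_def algebra_simps)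
  also have "\<dots> = fr e * E2 x"
    unfolding assms \<open>e * bar (fr v) = fr e * bar w\<close> by (simp add: E2_def algebra_simps)
  finally show ?thesis .
qed

text \<open>Both \<open>a * bar y = b * y\<close> and \<open>c * bar y = d * y\<close> follow, so
  the norms in \<open>e * (y * bar y)\<close> cancel in pairs.\<close>

lemma beta_nondegenerate:
  assumes "\<And>x. beta x y = 0" "y \<noteq> 0"
  shows "e = 0"
proof -
  have "(a * bar y + b * y) * bar X + (c * bar y + d * y) * X = 0" for X
  proof -
    obtain x where "fr x = X" by (rule fr_surj)
    then show ?thesis using assms(1)[of x] by (simp add: beta_def algebra_simps)
  qed
  note * = bar_linear_eq_0[OF this]
  then have ab: "a * bar y = b * y" and cd: "c * bar y = d * y"
    using eq_iff_add by blast+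
  have "e * (y * bar y) = (a * bar y) * bar (a * bar y) + (b * y) * bar (b * y)
      + ((c * bar y) * bar (c * bar y) + (d * y) * bar (d * y))"
    by (simp add: e_def algebra_simps)
  then show ?thesis using assms(2) by (simp add: ab cd)
qed

lemma inj_if_conditions:
  assumes e: "e \<noteq> 0" and v: "e * fr v = fr e * w" and t: "trace_F2 k \<tau> = 1"
  shows "inj (\<lambda>x. beta x x)"
proof (rule injI, rule ccontr)
  fix x y assume xy: "beta x x = beta y y" "x \<noteq> y"
  obtain P j \<kappa> where "twisted_quadrinomial k l a b c d P j \<kappa>"
    using e v by (rule twist_exists)
  then interpret twisted_quadrinomial k l F a b c d P j \<kappa> .
  have betaP: "beta (P x) y = beta x (P y)" for x y using beta_P t trace_\<tau> by simp
  define \<delta> where "\<delta> = x + y"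
  define \<phi> where "\<phi> = beta \<delta> \<delta>"
  have \<delta>: "\<delta> \<noteq> 0" using xy eq_iff_add[of x y] by (simp add: \<delta>_def)
  have y: "y = x + \<delta>" by (simp add: \<delta>_def)
  have "beta x \<delta> + beta \<delta> x + \<phi> = 0"
    using xy(1) unfolding y \<phi>_def by (simp add: add_ac)
  then have B: "beta x \<delta> + beta \<delta> x = \<phi>" by (rule eq_addI)
  show False
  proof (cases "E1 \<delta> = 0")
    case False
    \<comment> \<open>As \<open>dt \<delta> (P \<delta>)\<close> is nonzero, \<open>\<delta>\<close>
      and \<open>P \<delta>\<close> form a basis over the subfield.\<close>
    define g where "g = P \<delta>"
    define \<Delta> where "\<Delta> = dt \<delta> g"
    have \<Delta>: "\<Delta> \<noteq> 0" "bar \<Delta> = \<Delta>" using False e by (simp_all add: \<Delta>_def g_def dt_P_self)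
    define r s where "r = dt x g / \<Delta>" and "s = dt \<delta> x / \<Delta>"
    have rs: "bar r = r" "bar s = s" using \<Delta> by (simp_all add: r_def s_def)
    have x: "x = r * \<delta> + s * g"
      using dt_cramer[of x g \<delta>] \<Delta> by (simp add: r_def s_def \<Delta>_def field_simps)
    define \<psi> where "\<psi> = beta \<delta> g"
    have "(fr r + r) * \<phi> + (fr s + s) * \<psi> = \<phi>"
      using B unfolding x beta_add beta_scale[OF rs(1)] beta_scale[OF rs(2)]
      by (simp add: \<phi>_def \<psi>_def betaP g_def algebra_simps)
    have "(fr r + r + 1) * \<phi> + (fr s + s) * \<psi> = ((fr r + r) * \<phi> + (fr s + s) * \<psi>) + \<phi>"
      by (simp add: algebra_simps)
    also have "\<dots> = 0"
      unfolding \<open>(fr r + r) * \<phi> + (fr s + s) * \<psi> = \<phi>\<close> by simp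
    finally have *: "(fr r + r + 1) * \<phi> = (fr s + s) * \<psi>" by (rule eq_addI)
    have "bar (fr r) = fr r" "bar (fr s) = fr s" using rs by (simp_all flip: fr_simps(7))
    \<comment> \<open>Applying \<open>dt\<close> with \<open>\<psi>\<close> removes the multiple of
      \<open>\<psi>\<close>; since \<open>\<phi>\<close> and \<open>\<psi>\<close> are independent,
      \<open>fr r + r = 1\<close> would follow.\<close>
    then have "(fr r + r + 1) * dt \<phi> \<psi> = dt ((fr s + s) * \<psi>) \<psi>"
      using rs unfolding *[symmetric] by (subst dt_scale) simp_all
    also have "\<dots> = 0"
      using rs \<open>bar (fr s) = fr s\<close> by (subst dt_scale) simp_all
    finally have "fr r + r + 1 = 0 \<or> dt \<phi> \<psi> = 0" by simp
    moreover have "fr r + r + 1 \<noteq> 0"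
      using artin_schreier_ne_one[OF rs(1)] eq_iff_add by blast
    moreover have "E2 \<delta> \<noteq> 0"
      using fr_E1[OF v, of \<delta>] False e by auto
    then have "dt \<phi> \<psi> \<noteq> 0"
      using \<Delta> by (simp add: \<phi>_def \<psi>_def dt_beta_left \<Delta>_def)
    ultimately show False by simp
  next
    case True
    then have "dt \<delta> (P \<delta>) = 0" by (simp add: dt_P_self)
    then obtain q where q: "bar q = q" "P \<delta> = q * \<delta>" using \<delta> by (rule dt_eq_0E)
    have "(q\<^sup>2 + q) * \<delta> = j * \<delta>"
      using P_P[of \<delta>] unfolding q(2) P_scale[OF q(1)]
      by (simp add: power2_eq_square algebra_simps)
    then have qj: "q\<^sup>2 + q = j" using \<delta> by simp
    then have "j = 0" using j square_add_ne_one[OF q(1)] by auto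
    then have "q * (q + 1) = 0" using qj by (simp add: power2_eq_square algebra_simps)
    then have "q = 0 \<or> q = 1" using eq_iff_add[of q 1] by auto
    then have frq: "fr (q + 1) = q + 1" by auto
    have bq: "bar (q + 1) = q + 1" using q by simp
    have decomp: "\<exists>r. bar r = r \<and> beta z \<delta> = fr r * \<phi> \<and> beta \<delta> z = r * \<phi>" for z
    proof -
      \<comment> \<open>Since \<open>P\<close> has trace 1, its other eigenvalue is
        \<open>q + 1\<close>, so this \<open>y\<close> lies on the line of
        \<open>\<delta>\<close>.\<close>
      define y where "y = P z + (q + 1) * z"
      have "dt \<delta> y = dt \<delta> (P z) + dt \<delta> z + dt (P \<delta>) z"
        unfolding y_def q(2) dt_simps dt_scale[OF q(1)] dt_scale[OF bq]
        by (simp add: algebra_simps)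
      also have "\<dots> = 0" using dt_P[of \<delta> z] by (simp add: add_ac)
      finally obtain r where r: "bar r = r" "y = r * \<delta>" using \<delta> by (auto elim: dt_eq_0E)
      have "fr r * \<phi> = beta y \<delta>" by (simp add: r beta_scale \<phi>_def)
      also have "\<dots> = beta z \<delta>"
        unfolding y_def beta_add beta_scale[OF bq] betaP q(2) beta_scale[OF q(1)] frq
        by (simp add: algebra_simps)
      finally have 1: "beta z \<delta> = fr r * \<phi>" ..
      have "r * \<phi> = beta \<delta> y" by (simp add: r beta_scale \<phi>_def)
      also have "\<dots> = beta \<delta> (P z) + (q + 1) * beta \<delta> z"
        unfolding y_def by (simp only: beta_add beta_scale[OF bq])
      also have "beta \<delta> (P z) = q * beta \<delta> z"
        using \<open>q = 0 \<or> q = 1\<close> by (auto simp: q(2) simp flip: betaP)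
      finally show ?thesis using r 1 by (intro exI[of _ r]) (simp add: algebra_simps)
    qed
    have "\<phi> \<noteq> 0" using beta_nondegenerate[OF _ \<delta>] decomp e by (metis mult_zero_right)
    obtain r where "bar r = r" "(fr r + r) * \<phi> = \<phi>"
      using decomp[of x] B by (auto simp: algebra_simps)
    then show False using artin_schreier_ne_one \<open>\<phi> \<noteq> 0\<close> by simp
  qed
qed

end

section \<open>Necessity of conditions (3) and (1)\<close>

locale inj_quadrinomial = quadrinomial +
  assumes inj: "inj (\<lambda>x. beta x x)"
begin

lemma surj: obtains x where "beta x x = y"
proof -
  have "surj (\<lambda>x. beta x x)" using inj by (simp add: finite_UNIV_inj_surj)
  then obtain x where "y = beta x x" by (rule surjE)
  then show ?thesis using that by simp
qed

lemma beta_self_eq_0 [simp]: "beta x x = 0 \<longleftrightarrow> x = 0"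
  using inj_eq[OF inj, of x 0] by simp

text \<open>As each \<open>m\<close> in the subfield is some \<open>fr r * r\<close>, the value
  \<open>m * beta x x\<close> is already taken on the line of \<open>x\<close>.\<close>

lemma same_line:
  assumes "bar m = m" "beta y y = m * beta x x"
  shows "dt x y = 0"
proof -
  obtain r where r: "bar r = r" "fr r * r = m" using assms(1) by (rule subfield_power_surj)
  have "beta (r * x) (r * x) = m * beta x x"
    unfolding beta_scale[OF r(1)] r(2)[symmetric] by simp
  then have "r * x = y" using assms(2) injD[OF inj, of "r * x" y] by simp
  then have "dt x y = r * dt x x" using dt_scale r by metis
  then show ?thesis by simp
qed

lemma same_line':
  assumes "dt (beta x x) (beta y y) = 0" "x \<noteq> 0"
  shows "dt x y = 0"
  using assms by (metis dt_eq_0E same_line beta_self_eq_0)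

lemma trace_condition:
  assumes e: "e \<noteq> 0" and v: "e * fr v = fr e * w"
  shows "trace_F2 k \<tau> = 1"
proof (rule ccontr)
  assume t: "trace_F2 k \<tau> \<noteq> 1"
  obtain P j \<kappa> where "twisted_quadrinomial k l a b c d P j \<kappa>"
    using e v by (rule twist_exists)
  then interpret twisted_quadrinomial k l F a b c d P j \<kappa> .
  have "\<kappa> = 1" using t \<kappa> trace_\<tau> by simp
  then have *: "beta (P x) (P x) = beta x (j * x)" for x
    using beta_P[of x "P x"] by (simp add: P_P add_ac)
  obtain y where y: "dt 1 y = 1" using dt_eq_one[of 1] by auto
  \<comment> \<open>Injectivity forces \<open>P\<close> to be zero or the identity, neither of which
    has trace 1.\<close>
  from j show False
  proof
    assume "j = 0"
    then have "P x = 0" for x using *[of x] by simp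
    then show False using dt_P[of 1 y] y by (simp add: dt_def)
  next
    assume "j = 1"
    then have "P x = x" for x using *[of x] injD[OF inj, of "P x" x] by simp
    then show False using dt_P[of 1 y] y by simp
  qed
qed

lemma e_nonzero: "e \<noteq> 0"
proof
  assume e: "e = 0"
  from bij_is_surj[OF bij_power_2_power[of 1]] obtain \<rho> where "v = \<rho> ^ (2 ^ 1)" by (rule surjE)
  then have \<rho>: "\<rho>\<^sup>2 = v" by simp
  \<comment> \<open>With \<open>e = 0\<close> the form \<open>E1\<close> is the square of
    \<open>\<lambda>x. bar \<rho> * bar x + \<rho> * x\<close>, of which this is a nonzero
    zero.\<close>
  define \<delta> where "\<delta> = (if \<rho> = 0 then 1 else inverse \<rho>)"
  have \<delta>: "\<delta> \<noteq> 0" by (simp add: \<delta>_def)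
  have "bar \<rho> * bar \<delta> + \<rho> * \<delta> = bar (\<rho> * \<delta>) + \<rho> * \<delta>" by simp
  also have "\<dots> = 0" by (simp add: \<delta>_def del: bar_simps(2))
  finally have "(bar \<rho> * bar \<delta> + \<rho> * \<delta>)\<^sup>2 = 0" by simp
  then have E1: "E1 \<delta> = 0"
    unfolding E1_def e \<rho>[symmetric] by (simp add: power2_eq_square algebra_simps)
  define \<phi> where "\<phi> = beta \<delta> \<delta>"
  have \<phi>: "\<phi> \<noteq> 0" using \<delta> by (simp add: \<phi>_def)
  have right: "dt \<phi> (beta y \<delta>) = 0" for y
    using dt_beta_right[of \<delta> y] E1 by (simp add: \<phi>_def)
  have "E2 \<delta> = 0"
  proof (rule ccontr)
    assume E2: "E2 \<delta> \<noteq> 0"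
    obtain y where y: "dt \<delta> y = 1" using \<delta> by (rule dt_eq_one)
    define s where "s = dt \<phi> (beta y y)"
    \<comment> \<open>Adding this multiple of \<open>\<delta>\<close> to \<open>y\<close> brings the
      value onto the line of \<open>\<phi>\<close>, though the argument stays off the line of
      \<open>\<delta>\<close>.\<close>
    obtain r where r: "fr r = s / E2 \<delta>" by (rule fr_surj)
    have br: "bar r = r" by (rule subfield_frI) (simp add: r s_def)
    then have bfr: "bar (fr r) = fr r" by (simp flip: fr_simps(7))
    define z where "z = y + r * \<delta>"
    have "dt \<phi> (beta z z) = s + r * dt \<phi> (beta y \<delta>) + fr r * dt \<phi> (beta \<delta> y) + fr r * (r * dt \<phi> \<phi>)"
      unfolding z_def beta_add dt_simps beta_scale[OF br] dt_scale[OF br] dt_scale[OF bfr] s_def \<phi>_def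
      by (simp add: add_ac)
    also have "dt \<phi> (beta \<delta> y) = E2 \<delta>" using dt_beta_left[of \<delta> y] y by (simp add: \<phi>_def)
    finally have "dt \<phi> (beta z z) = 0" using E2 by (simp add: right r)
    then have "dt \<delta> z = 0" using \<delta> unfolding \<phi>_def by (rule same_line')
    then show False by (simp add: z_def dt_scale[OF br] y)
  qed
  then have left: "dt \<phi> (beta \<delta> y) = 0" for y
    using dt_beta_left[of \<delta> y] by (simp add: \<phi>_def)
  define D where "D = fr \<delta>"
  have D: "D \<noteq> 0" using \<delta> by (simp add: D_def)
  \<comment> \<open>With their conjugates, these are the coefficients of the form
    \<open>dt \<phi> (beta x y)\<close>, which vanishes if \<open>x\<close> or \<open>y\<close> is
    \<open>\<delta>\<close>.\<close>
  define a' b' where "a' = bar \<phi> * a + \<phi> * bar d" and "b' = bar \<phi> * b + \<phi> * bar c"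
  have "(a' * bar D + bar b' * D) * bar y + bar (a' * bar D + bar b' * D) * y = 0" for y
    using left[of y] by (simp add: dt_def beta_def a'_def b'_def D_def algebra_simps)
  then have H1: "a' * bar D + bar b' * D = 0" by (rule bar_linear_eq_0)
  have "(a' * bar \<delta> + b' * \<delta>) * bar X + bar (a' * bar \<delta> + b' * \<delta>) * X = 0" for X
  proof -
    obtain y where "fr y = X" by (rule fr_surj)
    then show ?thesis
      using right[of y] by (simp add: dt_def beta_def a'_def b'_def algebra_simps)
  qed
  then have H2: "a' * bar \<delta> + b' * \<delta> = 0" by (rule bar_linear_eq_0)
  \<comment> \<open>The form will be \<open>m * fr (dt \<delta> x) * dt \<delta> y\<close>;
    computing \<open>e\<close> then shows \<open>m = e = 0\<close>.\<close>
  define m where "m = a' / (D * \<delta>)"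
  have a': "a' = m * D * \<delta>" using D \<delta> by (simp add: m_def)
  have "\<delta> * (m * D * bar \<delta>) = \<delta> * b'"
    by (rule eq_addI) (use H2 in \<open>simp add: a' mult_ac\<close>)
  then have b': "b' = m * D * bar \<delta>" using \<delta> by simp
  have "D * (m * bar D * \<delta>) = D * bar b'"
    by (rule eq_addI) (use H1 in \<open>simp add: a' mult_ac\<close>)
  then have "bar b' = m * bar D * \<delta>" using D by simp
  then have bm: "bar m = m" using D \<delta> by (simp add: b')
  have \<phi>d: "\<phi> * bar d = a' + bar \<phi> * a" and \<phi>c: "\<phi> * bar c = b' + bar \<phi> * b"
    by (simp_all add: a'_def b'_def add_ac)
  have \<phi>d': "bar \<phi> * d = bar a' + \<phi> * bar a" and \<phi>c': "bar \<phi> * c = bar b' + \<phi> * bar b"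
    by (simp_all add: a'_def b'_def add_ac)
  define X where "X = bar \<phi> * bar D * (a * bar \<delta> + b * \<delta>)"
  have "\<phi> * bar \<phi> = bar \<phi> * beta \<delta> \<delta>" by (simp add: \<phi>_def)
  also have "\<dots> = X + D * ((bar \<phi> * c) * bar \<delta> + (bar \<phi> * d) * \<delta>)"
    by (simp add: X_def beta_def D_def algebra_simps)
  also have "\<dots> = X + bar X"
    unfolding \<phi>d' \<phi>c' a' b' by (simp add: X_def bm algebra_simps)
  finally have 1: "\<phi> * bar \<phi> = X + bar X" .
  have "\<phi> * bar \<phi> * e = \<phi> * bar \<phi> * (a * bar a + b * bar b)
      + (\<phi> * bar c) * (bar \<phi> * c) + (\<phi> * bar d) * (bar \<phi> * d)"
    by (simp add: e_def algebra_simps)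
  also have "\<dots> = m * (X + bar X)"
    unfolding \<phi>d' \<phi>c' \<phi>d \<phi>c a' b' by (simp add: X_def bm algebra_simps)
  finally have "m * (\<phi> * bar \<phi>) = 0" by (simp add: e 1)
  then have "m = 0" using \<phi> by simp
  then have "a' = 0" "b' = 0" by (simp_all add: a' b')
  have "dt \<phi> (beta x x) = (a' * bar (fr x) + bar b' * fr x) * bar x + bar (a' * bar (fr x) + bar b' * fr x) * x" for x
    by (simp add: dt_def beta_def a'_def b'_def algebra_simps)
  then have "dt \<phi> (beta x x) = 0" for x by (simp add: \<open>a' = 0\<close> \<open>b' = 0\<close>)
  then have "dt \<phi> z = 0" for z using surj[of z] by metis
  then have "\<phi> * bar z + bar \<phi> * z = 0" for z by (simp add: dt_def)
  then show False using bar_linear_eq_0(1) \<phi> by blast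
qed

end

section \<open>Iterates of \<open>fr\<close>, and traces of 2 by 2 matrices\<close>

context even_ext_field
begin

lemma funpow_fr_simps [simp]:
  "(fr ^^ i) (x + y) = (fr ^^ i) x + (fr ^^ i) y" "(fr ^^ i) (x * y) = (fr ^^ i) x * (fr ^^ i) y"
  "(fr ^^ i) (bar x) = bar ((fr ^^ i) x)" "(fr ^^ i) 0 = 0"
  by (induction i) simp_all

lemma fr_prod [simp]: "fr (prod g A) = (\<Prod>i\<in>A. fr (g i))"
  by (induction A rule: infinite_finite_induct) simp_all

lemma det_map_fr:
  fixes M :: "'a ^ 2 ^ 2"
  shows "det (map_matrix (fr ^^ i) M) = (fr ^^ i) (det M)"
  by (simp add: det_2)

text \<open>Take \<open>n = k div gcd l k\<close>, so that \<open>l * n\<close> is an odd multiple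
  of \<open>k\<close>. The iterate \<open>fr ^^ k\<close> is \<open>bar\<close> too, but below
  \<open>k\<close> the residues repeat unless \<open>k\<close> and \<open>l\<close> are
  coprime.\<close>

lemma period_exists:
  obtains n where "n > 0" "\<And>x. (fr ^^ n) x = bar x" "inj_on (\<lambda>i. l * i mod k) {..<n}"
proof -
  have "gcd l k \<noteq> 0" using k_pos by simp
  then obtain m n where lm: "l = m * gcd l k" and kn: "k = n * gcd l k" and mn: "coprime m n"
    using gcd_coprime_exists[of l k] by blast
  define g where "g = gcd l k"
  have l: "l = m * g" and k: "k = n * g" using lm kn by (simp_all add: g_def)
  have "odd m" using odd_l l by auto
  show ?thesis
  proof
    show "n > 0" using k_pos k by (cases n) auto
    show "(fr ^^ n) x = bar x" for x
      by (rule funpow_fr_odd_multiple[of _ m]) (simp_all add: \<open>odd m\<close> l k)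
    show "inj_on (\<lambda>i. l * i mod k) {..<n}"
    proof (rule inj_onI)
      fix i j assume ij: "i \<in> {..<n}" "j \<in> {..<n}" "l * i mod k = l * j mod k"
      have "g * ((m * i) mod n) = g * ((m * j) mod n)"
        using ij(3) unfolding mult_mod_right by (simp add: l k ac_simps)
      then have "[m * i = m * j] (mod n)" using \<open>gcd l k \<noteq> 0\<close> unfolding cong_def g_def by (metis mult_cancel1)
      then have "[i = j] (mod n)" using mn by (simp add: cong_mult_lcancel_nat)
      then show "i = j" using ij by (simp add: cong_less_modulus_unique_nat)
    qed
  qed
qed

lemma power_2_power_mod: "(x :: 'a) ^ (2 ^ (m mod (2 * k))) = x ^ (2 ^ m)"
proof -
  have "x ^ (2 ^ (2 * k * i + r)) = x ^ (2 ^ r)" for i r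
  proof -
    have "x ^ (2 ^ (2 * k * i)) = x"
      by (rule finite_field_power_card_power_eq_same[of _ i]) (simp add: card_F' power_mult)
    then show ?thesis by (simp add: power_add power_mult)
  qed
  from this[of "m div (2 * k)" "m mod (2 * k)"] show ?thesis by simp
qed

text \<open>The products of the monomials \<open>x ^ (2 ^ (l * i))\<close> and \<open>bar x ^ (2 ^ (l * i))\<close> have pairwise
  distinct exponents below the order of the field, since these exponents have distinct binary
  expansions.\<close>

lemma frobenius_monomials_independent:
  fixes c :: "nat set \<Rightarrow> 'a"
  assumes inj: "inj_on (\<lambda>i. l * i mod k) {..<n}"
    and zero: "\<And>x. (\<Sum>S\<in>Pow {..<n}. (\<Prod>i<n. if i \<in> S then (fr ^^ i) x else (fr ^^ i) (bar x)) * c S) = 0"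
    and S: "S \<subseteq> {..<n}"
  shows "c S = 0"
proof -
  \<comment> \<open>Exponents of 2 count modulo \<open>2 * k\<close>, and \<open>bar\<close> shifts
    them by \<open>k\<close>.\<close>
  define r where "r = (\<lambda>S i. (l * i + (if i \<in> S then 0 else k)) mod (2 * k))"
  have rk: "r S i mod k = l * i mod k" for S i
    by (simp add: r_def mod_mod_cancel)
  have r_less: "r S i < 2 * k" for S i using k_pos by (simp add: r_def)
  have r_inj: "i = j" if "r S i = r T j" "i < n" "j < n" for S T i j
  proof (rule inj_onD[OF inj])
    show "l * i mod k = l * j mod k" using rk[of S i] rk[of T j] that(1) by simp
  qed (use that in auto)
  have r_sub: "i \<in> T" if "r S i = r T i" "i \<in> S" for S T i
  proof (rule ccontr)
    assume "i \<notin> T"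
    then have "(l * i) mod (2 * k) = (l * i + k) mod (2 * k)" using that by (simp add: r_def)
    then have "2 * k dvd k"
      using mod_eq_dvd_iff_nat[of "l * i" "l * i + k" "2 * k"] by simp
    then show False using k_pos by (auto dest: dvd_imp_le)
  qed
  define t where "t = (\<lambda>S. set_encode (r S ` {..<n}))"
  have sub: "S \<subseteq> T" if "t S = t T" "S \<subseteq> {..<n}" for S T
  proof
    fix i assume i: "i \<in> S"
    have "r S ` {..<n} = r T ` {..<n}" using that(1) by (simp add: t_def set_encode_eq)
    moreover have "i < n" using i that by auto
    ultimately obtain j where "j < n" "r S i = r T j" by (metis imageE imageI lessThan_iff)
    then show "i \<in> T" using r_inj r_sub i \<open>i < n\<close> by metis
  qed
  have mono: "(\<Prod>i<n. if i \<in> S then (fr ^^ i) x else (fr ^^ i) (bar x)) = x ^ t S" for S x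
  proof -
    have "inj_on (r S) {..<n}" using r_inj by (auto simp: inj_on_def)
    then have "t S = (\<Sum>i<n. 2 ^ r S i)" by (simp add: t_def set_encode_def sum.reindex)
    moreover have "(if i \<in> S then (fr ^^ i) x else (fr ^^ i) (bar x)) = x ^ (2 ^ r S i)" for i
      unfolding r_def power_2_power_mod
      by (simp add: funpow_fr bar_def power_add mult.commute flip: power_mult)
    ultimately show ?thesis by (simp add: power_sum)
  qed
  have bound: "t S < card (UNIV :: 'a set)" for S
  proof -
    have "t S \<le> (\<Sum>i<2*k. 2 ^ i)"
      unfolding t_def set_encode_def using r_less by (intro sum_mono2) auto
    also have "\<dots> = 2 ^ (2 * k) - Suc 0"
      using mask_eq_sum_exp_nat[of "2 * k"] by (simp add: lessThan_def)
    also have "\<dots> < 2 ^ (2 * k)" by simp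
    finally show ?thesis by (simp add: card_F')
  qed
  show ?thesis
  proof (rule power_sum_eq_0_imp_coeffs[of "Pow {..<n}" t])
    show "inj_on t (Pow {..<n})"
      by (rule inj_onI) (metis PowD sub subset_antisym)
  qed (use zero S bound in \<open>auto simp: mono\<close>)
qed

text \<open>The hypotheses say that \<open>S * X\<close>, \<open>T * X\<close> and
  \<open>S * T * X\<close> are traceless for a traceless \<open>X\<close>; the conclusion is the
  upper right entry of \<open>S * T = T * S\<close>.\<close>

lemma commutator_entry:
  fixes x1 x2 x3 s1 s2 s3 s4 t1 t2 t3 t4 :: 'a
  assumes S: "(s1 + s4) * x1 + s2 * x3 + s3 * x2 = 0"
    and T: "(t1 + t4) * x1 + t2 * x3 + t3 * x2 = 0"
    and ST: "(s1 * t1 + s2 * t3 + s3 * t2 + s4 * t4) * x1 + (s1 * t2 + s2 * t4) * x3 + (s3 * t1 + s4 * t3) * x2 = 0"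
    and x: "x1 * x1 + x2 * x3 \<noteq> 0"
  shows "s2 * (t1 + t4) = t2 * (s1 + s4)"
proof -
  have "(x1 * x1 + x2 * x3) * (s2 * (t1 + t4) + t2 * (s1 + s4)) =
      x2 * ((s1 * t1 + s2 * t3 + s3 * t2 + s4 * t4) * x1 + (s1 * t2 + s2 * t4) * x3 + (s3 * t1 + s4 * t3) * x2)
    + (t2 * x1 + t1 * x2) * ((s1 + s4) * x1 + s2 * x3 + s3 * x2)
    + (s2 * x1 + s4 * x2) * ((t1 + t4) * x1 + t2 * x3 + t3 * x2)"
    by (simp add: algebra_simps)
  then have "s2 * (t1 + t4) + t2 * (s1 + s4) = 0" using x unfolding S T ST by simp
  then show ?thesis using eq_iff_add by blast
qed

text \<open>In characteristic 2 the adjugate needs no signs.\<close>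

definition adj2 :: "'a ^ 2 ^ 2 \<Rightarrow> 'a ^ 2 ^ 2" where
  "adj2 M = mat2 (M $ 2 $ 2) (M $ 1 $ 2) (M $ 2 $ 1) (M $ 1 $ 1)"

lemma adj2_mult: "M ** adj2 M = smat (det M) (mat 1)" "adj2 M ** M = smat (det M) (mat 1)"
  by (simp_all add: adj2_def entries2 det_2 mat_def algebra_simps)

text \<open>If \<open>X\<close>, \<open>S * X\<close>, \<open>T * X\<close>, \<open>S * T * X\<close> are traceless then \<open>X\<close> conjugates \<open>S\<close>, \<open>T\<close> and \<open>S * T\<close> into
  their adjugates, so that \<open>S\<close> and \<open>T\<close> commute. Here this is applied to
  \<open>S = adj2 G ** H\<close> and \<open>T = H' ** adj2 G'\<close>.\<close>

lemma trace_orthogonal_imp: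
  fixes G H G' H' C :: "'a ^ 2 ^ 2"
  assumes tr: "trace (G ** G' ** C) = 0" "trace (H ** G' ** C) = 0"
    "trace (G ** H' ** C) = 0" "trace (H ** H' ** C) = 0"
    and det: "det G \<noteq> 0" "det G' \<noteq> 0" "det C \<noteq> 0"
  defines "S \<equiv> adj2 G ** H" and "T \<equiv> H' ** adj2 G'"
  shows "S $ 1 $ 2 * trace T = T $ 1 $ 2 * trace S"
proof -
  define X where "X = G' ** C ** G"
  have "trace X = 0"
    unfolding X_def using tr(1) trace_mul_sym[of "G' ** C" G] by (simp add: matrix_mul_assoc)
  then have "X $ 2 $ 2 + X $ 1 $ 1 = 0" by (simp add: trace_def sum_2 add.commute)
  then have x4: "X $ 2 $ 2 = X $ 1 $ 1" by (rule eq_addI)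
  have "trace (S ** X) = trace ((G ** adj2 G) ** H ** G' ** C)"
    unfolding X_def S_def using trace_mul_sym[of "adj2 G ** H ** G' ** C" G] by (simp add: matrix_mul_assoc)
  also have "\<dots> = 0" using tr by (simp add: adj2_mult smat_mult_left trace_smat)
  finally have SX: "trace (S ** X) = 0" .
  have "trace (T ** X) = trace (G ** H' ** (adj2 G' ** G') ** C)"
    unfolding X_def T_def using trace_mul_sym[of "H' ** adj2 G' ** G' ** C" G] by (simp add: matrix_mul_assoc)
  also have "\<dots> = 0" using tr by (simp add: adj2_mult smat_mult_left trace_smat)
  finally have TX: "trace (T ** X) = 0" .
  have "trace (S ** T ** X) = trace ((G ** adj2 G) ** H ** H' ** (adj2 G' ** G') ** C)"
    unfolding X_def T_def S_def using trace_mul_sym[of "adj2 G ** H ** H' ** adj2 G' ** G' ** C" G]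
    by (simp add: matrix_mul_assoc)
  also have "\<dots> = 0" using tr by (simp add: adj2_mult smat_mult_left trace_smat)
  finally have STX: "trace (S ** T ** X) = 0" .
  have "det X \<noteq> 0" using det by (simp add: X_def det_mul)
  then show ?thesis
    using commutator_entry[of "S $ 1 $ 1" "S $ 2 $ 2" "X $ 1 $ 1" "S $ 1 $ 2" "X $ 2 $ 1" "S $ 2 $ 1"
        "X $ 1 $ 2" "T $ 1 $ 1" "T $ 2 $ 2" "T $ 1 $ 2" "T $ 2 $ 1"] SX TX STX
    by (simp add: entries2 det_2 x4 algebra_simps)
qed

end

section \<open>Necessity of condition (2)\<close>

context inj_quadrinomial
begin

text \<open>As \<open>fr ^^ n = bar\<close> swaps the coordinates \<open>(bar x, x)\<close>, the
  factor \<open>J\<close> turns the matrix product into the matrix of the linear map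
  \<open>\<Phi> ^^ n\<close>.\<close>

definition J :: "'a ^ 2 ^ 2" where "J = mat2 0 1 1 0"
text \<open>In these coordinates \<open>\<Phi>\<close> has the matrix
  \<open>smat \<theta> M0 + smat (bar \<theta>) N0\<close>.\<close>

definition M0 :: "'a ^ 2 ^ 2" where "M0 = mat2 b d a c"
definition N0 :: "'a ^ 2 ^ 2" where "N0 = mat2 (bar c) (bar a) (bar d) (bar b)"

text \<open>The zeros of the form \<open>\<theta> * beta x x + bar (\<theta> * beta x x)\<close> are the eigenvectors of the
  semilinear map \<open>\<Phi>\<close> below. Injectivity means that for each \<open>\<theta>\<close> there is exactly one eigenline,
  and then the linear map \<open>\<Phi> ^^ n\<close> has trace zero.\<close>

lemma trace_matprod_pencil_eq_0:
  assumes n: "n > 0" "\<And>x. (fr ^^ n) x = bar x"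
  shows "trace (matprod (\<lambda>i. map_matrix (fr ^^ i) (smat \<theta> M0 + smat (bar \<theta>) N0)) n ** J) = 0"
proof (cases "\<theta> = 0")
  case True
  obtain m where m: "n = Suc m" using n by (cases n) auto
  have "map_matrix (fr ^^ m) (smat \<theta> M0 + smat (bar \<theta>) N0) = 0"
    using True by (simp add: vec_eq_iff)
  then show ?thesis by (simp add: m entries2)
next
  case False
  define \<alpha> \<gamma> where "\<alpha> = \<theta> * a + bar \<theta> * bar d" and "\<gamma> = \<theta> * c + bar \<theta> * bar b"
  define \<Phi> where "\<Phi> = (\<lambda>x. \<alpha> * bar (fr x) + \<gamma> * fr x)"
  define Y where "Y = smat \<theta> M0 + smat (bar \<theta>) N0"
  have Y: "Y = mat2 (bar \<gamma>) (bar \<alpha>) \<alpha> \<gamma>"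
    by (simp add: Y_def M0_def N0_def \<alpha>_def \<gamma>_def entries2 add.commute)
  have dt_\<Phi>: "dt x (\<Phi> x) = \<theta> * beta x x + bar (\<theta> * beta x x)" for x
    by (simp add: dt_def \<Phi>_def \<alpha>_def \<gamma>_def beta_def algebra_simps)
  have \<Phi>_add: "\<Phi> (x + y) = \<Phi> x + \<Phi> y" for x y by (simp add: \<Phi>_def algebra_simps)
  have \<Phi>_scale: "\<Phi> (r * x) = fr r * \<Phi> x" if "bar r = r" for r x
  proof -
    have "bar (fr r) = fr r" using that by (simp flip: fr_simps(7))
    then show ?thesis by (simp add: \<Phi>_def algebra_simps)
  qed
  \<comment> \<open>Now \<open>\<theta> * beta x x = 1\<close>, so the form vanishes at
    \<open>x\<close>.\<close>
  obtain x where x: "beta x x = inverse \<theta>" by (rule surj)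
  have x0: "x \<noteq> 0" using x False by auto
  have "dt x (\<Phi> x) = 0" unfolding dt_\<Phi> x using False by (simp del: bar_simps(2))
  then obtain \<rho> where \<rho>: "bar \<rho> = \<rho>" "\<Phi> x = \<rho> * x" using x0 by (rule dt_eq_0E)
  obtain y where y: "dt x y = 1" using x0 by (rule dt_eq_one)
  define \<mu> z where "\<mu> = dt x (\<Phi> y)" and "z = dt (\<Phi> y) y"
  have \<mu>: "bar \<mu> = \<mu>" and z: "bar z = z" by (simp_all add: \<mu>_def z_def)
  have \<Phi>y: "\<Phi> y = \<mu> * y + z * x"
    using dt_cramer[of "\<Phi> y" y x] y by (simp add: \<mu>_def z_def add.commute)
  have unique: "dt x u = 0" if "dt u (\<Phi> u) = 0" for u
  proof -
    have "\<theta> * beta u u = bar (\<theta> * beta u u)" using that eq_iff_add unfolding dt_\<Phi> by blast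
    moreover have "beta u u = \<theta> * beta u u * beta x x" unfolding x using False by simp
    ultimately show ?thesis by (intro same_line[of "\<theta> * beta u u"]) simp_all
  qed
  define K where "K = {r :: 'a. bar r = r}"
  \<comment> \<open>If \<open>h r = z\<close> then \<open>y + r * x\<close> is an eigenvector; as
    there is no second eigenline, \<open>h\<close> misses \<open>z\<close> and, by finiteness, is
    not injective.\<close>
  define h where "h = (\<lambda>r. fr r * \<rho> + \<mu> * r)"
  have barfr: "bar (fr r) = fr r" if "bar r = r" for r using that by (simp flip: fr_simps(7))
  have "h ` K \<subseteq> K" by (auto simp: h_def K_def \<rho> \<mu> barfr)
  moreover have "z \<notin> h ` K"
  proof
    assume "z \<in> h ` K"
    then obtain r where r: "bar r = r" "z = fr r * \<rho> + \<mu> * r" by (auto simp: h_def K_def)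
    have "\<Phi> (y + r * x) = \<mu> * (y + r * x)"
      unfolding \<Phi>_add \<Phi>_scale[OF r(1)] \<Phi>y \<rho>(2) r(2) by (simp add: algebra_simps)
    then have "dt (y + r * x) (\<Phi> (y + r * x)) = 0"
      using dt_scale(2)[OF \<mu>, of "y + r * x" "y + r * x"] by simp
    then have "dt x (y + r * x) = 0" by (rule unique)
    then show False using y dt_scale[OF r(1)] by simp
  qed
  ultimately have "\<not> inj_on h K"
    using endo_inj_surj[of K h] z by (auto simp: K_def)
  then obtain r1 r2 where "r1 \<in> K" "r2 \<in> K" "h r1 = h r2" "r1 \<noteq> r2" by (auto simp: inj_on_def)
  moreover define r where "r = r1 + r2"
  ultimately have r: "bar r = r" "r \<noteq> 0" and "h r1 + h r2 = 0"
    using eq_iff_add by (auto simp: K_def)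
  then have "fr r * \<rho> + \<mu> * r = 0"
    by (simp add: h_def r_def algebra_simps)
  then have r_eq: "fr r * \<rho> = \<mu> * r" using eq_iff_add by blast
  \<comment> \<open>A twisted norm: \<open>N j \<rho>\<close> and \<open>N j \<mu>\<close> are the
    diagonal entries of \<open>\<Phi> ^^ j\<close> in the basis \<open>x\<close>, \<open>y\<close>.
    For \<open>j = n\<close> it agrees at \<open>r\<close> and \<open>fr r\<close>, whence
    \<open>N n \<rho> = N n \<mu>\<close>.\<close>
  define N where "N = (\<lambda>j x. \<Prod>i<j. (fr ^^ i) x)"
  have N_Suc: "N (Suc j) x = x * fr (N j x)" for j x
    by (simp add: N_def prod.lessThan_Suc_shift del: prod.lessThan_Suc)
  have N_0: "N 0 x = 1" for x by (simp add: N_def)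
  have N_mult: "N j (x * y) = N j x * N j y" for j x y by (simp add: N_def prod.distrib)
  have N_fr: "N j (fr x) = fr (N j x)" for j x by (simp add: N_def flip: funpow_swap1)
  have "N (Suc n) r = N n r * bar r" by (simp add: N_def n)
  then have "r * N n (fr r) = r * N n r"
    using r unfolding N_Suc N_fr by (simp add: mult.commute)
  then have "N n (fr r) = N n r" using r by simp
  moreover have "N n r \<noteq> 0"
  proof -
    have "(fr ^^ i) r \<noteq> 0" for i using r by (induction i) simp_all
    then show ?thesis by (simp add: N_def)
  qed
  ultimately have N_eq: "N n \<rho> = N n \<mu>"
    using arg_cong[OF r_eq, of "N n"] unfolding N_mult by (simp add: mult.commute)
  have bar_N: "bar (N j s) = N j s" if "bar s = s" for s j
    using that barfr by (induction j) (simp_all add: N_0 N_Suc)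
  have iter_x: "(\<Phi> ^^ j) x = N j \<rho> * x" for j
    by (induction j) (simp_all add: N_0 N_Suc \<Phi>_scale bar_N \<rho>)
  have iter_y: "\<exists>s. bar s = s \<and> (\<Phi> ^^ j) y = N j \<mu> * y + s * x" for j
  proof (induction j)
    case 0
    show ?case by (intro exI[of _ 0]) (simp add: N_def)
  next
    case (Suc j)
    then obtain s where s: "bar s = s" "(\<Phi> ^^ j) y = N j \<mu> * y + s * x" by blast
    have "\<Phi> (N j \<mu> * y + s * x) = fr (N j \<mu>) * (\<mu> * y + z * x) + fr s * (\<rho> * x)"
      unfolding \<Phi>_add \<Phi>_scale[OF bar_N[OF \<mu>]] \<Phi>_scale[OF s(1)] \<Phi>y \<rho>(2) by (rule refl)
    then have "(\<Phi> ^^ Suc j) y = N (Suc j) \<mu> * y + (fr (N j \<mu>) * z + fr s * \<rho>) * x"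
      by (simp add: s(2) N_Suc algebra_simps)
    moreover have "bar (fr (N j \<mu>) * z + fr s * \<rho>) = fr (N j \<mu>) * z + fr s * \<rho>"
      by (simp add: barfr bar_N \<mu> s(1) z \<rho>(1))
    ultimately show ?case by blast
  qed
  define X where "X = matprod (\<lambda>i. map_matrix (fr ^^ i) Y)"
  have X: "bar ((\<Phi> ^^ j) u) = X j $ 1 $ 1 * (fr ^^ j) (bar u) + X j $ 1 $ 2 * (fr ^^ j) u
    \<and> (\<Phi> ^^ j) u = X j $ 2 $ 1 * (fr ^^ j) (bar u) + X j $ 2 $ 2 * (fr ^^ j) u" for j u
  proof (induction j arbitrary: u)
    case 0
    show ?case by (simp add: X_def mat_def)
  next
    case (Suc j)
    have iter: "(\<Phi> ^^ Suc j) u = (\<Phi> ^^ j) (\<Phi> u)" by (simp add: funpow_swap1)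
    have fr_\<Phi>: "(fr ^^ j) (\<Phi> u) = (fr ^^ j) \<alpha> * bar ((fr ^^ Suc j) u) + (fr ^^ j) \<gamma> * (fr ^^ Suc j) u"
      by (simp add: \<Phi>_def funpow_swap1)
    have ent: "X (Suc j) $ i $ 1 = X j $ i $ 1 * bar ((fr ^^ j) \<gamma>) + X j $ i $ 2 * (fr ^^ j) \<alpha>"
      "X (Suc j) $ i $ 2 = X j $ i $ 1 * bar ((fr ^^ j) \<alpha>) + X j $ i $ 2 * (fr ^^ j) \<gamma>" for i
      by (simp_all add: X_def Y matrix_matrix_mult_def sum_2)
    show ?case
      unfolding iter ent using Suc[of "\<Phi> u", THEN conjunct1] Suc[of "\<Phi> u", THEN conjunct2]
      by (intro conjI) (simp_all only: fr_\<Phi> funpow_fr_simps bar_simps algebra_simps)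
  qed
  obtain s where s: "bar s = s" "(\<Phi> ^^ n) y = N n \<mu> * y + s * x" using iter_y by blast
  have "dt ((\<Phi> ^^ n) u) u' + dt u ((\<Phi> ^^ n) u') = (X n $ 1 $ 2 + X n $ 2 $ 1) * dt u u'" for u u'
    unfolding dt_def X[THEN conjunct1] unfolding X[THEN conjunct2] by (simp add: n algebra_simps)
  from this[of x y] have "X n $ 1 $ 2 + X n $ 2 $ 1 = N n \<rho> + N n \<mu>"
    by (simp add: iter_x s y dt_scale bar_N \<rho> \<mu>)
  also have "\<dots> = 0" by (simp add: N_eq)
  finally show ?thesis by (simp add: X_def Y_def J_def entries2)
qed

text \<open>By independence of the Frobenius monomials in \<open>\<theta>\<close>, the trace
  vanishes for each choice of \<open>M0\<close> or \<open>N0\<close> in every factor, hence for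
  arbitrary scalars.\<close>

lemma trace_matprod_span_eq_0:
  assumes n: "n > 0" "\<And>x. (fr ^^ n) x = bar x" and inj: "inj_on (\<lambda>i. l * i mod k) {..<n}"
  shows "trace (matprod (\<lambda>i. smat (x i) (map_matrix (fr ^^ i) M0) + smat (y i) (map_matrix (fr ^^ i) N0)) n ** J) = 0"
proof -
  define c where "c = (\<lambda>S. trace (matprod (\<lambda>i. if i \<in> S then map_matrix (fr ^^ i) M0 else map_matrix (fr ^^ i) N0) n ** J))"
  have "(\<Sum>S\<in>Pow {..<n}. (\<Prod>i<n. if i \<in> S then (fr ^^ i) \<theta> else (fr ^^ i) (bar \<theta>)) * c S) = 0" for \<theta>
  proof -
    have eq: "map_matrix (fr ^^ i) (smat \<theta> M0 + smat (bar \<theta>) N0) =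
        smat ((fr ^^ i) \<theta>) (map_matrix (fr ^^ i) M0) + smat ((fr ^^ i) (bar \<theta>)) (map_matrix (fr ^^ i) N0)" for i
      by (simp add: vec_eq_iff)
    show ?thesis
      using trace_matprod_pencil_eq_0[OF n, of \<theta>] unfolding eq trace_matprod_expand c_def .
  qed
  then have "c S = 0" if "S \<subseteq> {..<n}" for S
    using frobenius_monomials_independent[OF inj] that by blast
  then show ?thesis by (simp add: trace_matprod_expand c_def)
qed

lemma v_w_condition: "e * fr v = fr e * w"
proof -
  obtain n where n: "n > 0" "\<And>x. (fr ^^ n) x = bar x" and inj: "inj_on (\<lambda>i. l * i mod k) {..<n}"
    using period_exists by blast
  note tr0 = trace_matprod_span_eq_0[OF n inj]
  show ?thesis
  proof (cases "n = 1")
    case True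
    \<comment> \<open>A single factor is too few for the commutation argument, but the trace itself
      gives \<open>a = d\<close>.\<close>
    have fr: "fr x = bar x" for x using n True by simp
    have "a + d = 0"
      using tr0[of "\<lambda>_. 1" "\<lambda>_. 0"] True
      by (simp add: M0_def N0_def J_def entries2 mat_def add.commute)
    then have "a = d" by (rule eq_addI)
    have "bar v = w"
      unfolding v_def w_def unfolding \<open>a = d\<close> by (simp add: algebra_simps)
    then show ?thesis by (simp add: fr)
  next
    case False
    then obtain m where m: "n = 2 + m" using n by (metis One_nat_def Suc_1 le_Suc_ex less_one linorder_not_less not_less_eq_eq nat_less_le)
    \<comment> \<open>If \<open>det M0 = 0\<close> then \<open>M0 + N0\<close> has determinant
      \<open>e\<close>, so \<open>G\<close> is invertible in either case.\<close>
    define \<sigma> :: 'a where "\<sigma> = (if det M0 = 0 then 1 else 0)"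
    define G where "G = smat 1 M0 + smat \<sigma> N0"
    have "det (smat 1 M0 + smat 1 N0) = det M0 + e + bar (det M0)"
      by (simp add: det_2 M0_def N0_def e_def algebra_simps)
    moreover have "smat 1 M0 + smat 0 N0 = M0" by (simp add: vec_eq_iff)
    ultimately have G: "det G \<noteq> 0" using e_nonzero by (auto simp: G_def \<sigma>_def)
    define C where "C = matprod (\<lambda>i. map_matrix (fr ^^ (2 + i)) G) m ** J"
    have fr0: "(fr ^^ i) x \<noteq> 0" if "x \<noteq> 0" for i x using that by (induction i) simp_all
    have "det (matprod (\<lambda>i. map_matrix (fr ^^ (2 + i)) G) m) \<noteq> 0"
      unfolding det_matprod det_map_fr prod_zero_iff[OF finite_lessThan] using fr0[OF G] by blast
    moreover have "det J = 1" by (simp add: J_def det_2)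
    ultimately have C: "det C \<noteq> 0" by (simp add: C_def det_mul)
    \<comment> \<open>The first two factors stay arbitrary; all others are conjugates of
      \<open>G\<close>.\<close>
    have tr: "trace ((smat x M0 + smat y N0) ** map_matrix fr (smat x' M0 + smat y' N0) ** C) = 0" for x y x' y'
    proof -
      define X where "X = (\<lambda>i :: nat. if i = 0 then x else if i = 1 then fr x' else 1)"
      define Y where "Y = (\<lambda>i :: nat. if i = 0 then y else if i = 1 then fr y' else (fr ^^ i) \<sigma>)"
      define Z where "Z = (\<lambda>i. smat (X i) (map_matrix (fr ^^ i) M0) + smat (Y i) (map_matrix (fr ^^ i) N0))"
      have Z: "Z 0 = smat x M0 + smat y N0" "Z 1 = map_matrix fr (smat x' M0 + smat y' N0)"
        "Z (2 + i) = map_matrix (fr ^^ (2 + i)) G" for i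
        by (simp_all add: Z_def X_def Y_def G_def vec_eq_iff)
      have prod: "matprod Z n = Z 0 ** Z 1 ** matprod (\<lambda>i. Z (2 + i)) m"
        unfolding m matprod_add by (simp add: numeral_2_eq_2)
      show ?thesis
        using tr0[of X Y] unfolding Z_def[symmetric] prod Z C_def by (simp only: matrix_mul_assoc)
    qed
    have N0: "N0 = smat 0 M0 + smat 1 N0" by (simp add: vec_eq_iff)
    have "(adj2 G ** N0) $ 1 $ 2 * trace (map_matrix fr N0 ** adj2 (map_matrix fr G)) =
        (map_matrix fr N0 ** adj2 (map_matrix fr G)) $ 1 $ 2 * trace (adj2 G ** N0)"
    proof (rule trace_orthogonal_imp[OF _ _ _ _ G _ C])
      show "det (map_matrix fr G) \<noteq> 0" using G det_map_fr[of 1 G] by simp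
      show "trace (G ** map_matrix fr G ** C) = 0" unfolding G_def by (rule tr)
      show "trace (N0 ** map_matrix fr G ** C) = 0"
        unfolding G_def by (subst N0) (rule tr)
      show "trace (G ** map_matrix fr N0 ** C) = 0"
        unfolding G_def using tr[of 1 \<sigma> 0 1] N0 by simp
      show "trace (N0 ** map_matrix fr N0 ** C) = 0"
        using tr[of 0 1 0 1] N0 by simp
    qed
    \<comment> \<open>The multiple of \<open>N0\<close> in \<open>G\<close> contributes a scalar
      matrix, whose upper right entry and trace vanish in characteristic 2.\<close>
    moreover have "(adj2 G ** N0) $ 1 $ 2 = w" "trace (adj2 G ** N0) = e"
      by (simp_all add: adj2_def G_def M0_def N0_def w_def e_def entries2 algebra_simps)
    moreover have "(map_matrix fr N0 ** adj2 (map_matrix fr G)) $ 1 $ 2 = fr v"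
        "trace (map_matrix fr N0 ** adj2 (map_matrix fr G)) = fr e"
      by (simp_all add: adj2_def G_def M0_def N0_def v_def e_def entries2 algebra_simps)
    ultimately show ?thesis by (simp add: mult.commute)
  qed
qed

end

section \<open>The criterion for the form and for the polynomial\<close>

lemma (in quadrinomial) inj_iff:
  "inj (\<lambda>x. beta x x) \<longleftrightarrow> e \<noteq> 0 \<and> e * fr v = fr e * w \<and> trace_F2 k \<tau> = 1"
proof
  assume "inj (\<lambda>x. beta x x)"
  then interpret inj_quadrinomial k l F a b c d
    by unfold_locales
  show "e \<noteq> 0 \<and> e * fr v = fr e * w \<and> trace_F2 k \<tau> = 1"
    using e_nonzero v_w_condition trace_condition by blast
qed (use inj_if_conditions in blast)

theorem corollary9p1:
  fixes k l q Q :: nat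
    and a b c d e :: "'a :: finite_field"
    and A f :: "'a poly"
  assumes "odd k" and "odd l"
  defines "q \<equiv> 2 ^ k" and "Q \<equiv> 2 ^ l"
  assumes "card (UNIV :: 'a set) = q\<^sup>2"
  defines "A \<equiv> monom a (Q + 1) + monom b Q + monom c 1 + [:d:]"
  defines "f \<equiv> monom 1 (Q + 1) * pcompose A (monom 1 (q - 1))"
  defines "e \<equiv> a ^ (q + 1) + b ^ (q + 1) + c ^ (q + 1) + d ^ (q + 1)"
  shows "permutation_poly f \<longleftrightarrow>
    e \<noteq> 0 \<and>
    (a ^ q * b + c ^ q * d) ^ Q = e ^ (Q - 1) * (a ^ q * c + b ^ q * d) \<and>
    trace_F2 k ((b ^ (q + 1) + c ^ (q + 1)) / e) = 1"
proof -
  interpret QF: quadrinomial k l "TYPE('a)" a b c d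
    using assms(1,2,5) by unfold_locales (simp_all add: q_def)
  have q: "x ^ q = QF.bar x" and Q: "x ^ Q = QF.fr x" for x
    by (simp_all add: q_def Q_def QF.bar_def QF.fr_def)
  have e: "e = QF.e" and v: "a ^ q * b + c ^ q * d = QF.v" and w: "a ^ q * c + b ^ q * d = QF.w"
    by (simp_all add: e_def QF.e_def QF.v_def QF.w_def q)
  have \<tau>: "(b ^ (q + 1) + c ^ (q + 1)) / e = QF.\<tau>"
    by (simp add: QF.\<tau>_def q flip: e)
  have f: "poly f x = QF.beta x x" for x
  proof (cases "x = 0")
    case True
    then show ?thesis by (simp add: f_def poly_monom)
  next
    case False
    have "q > 0" by (simp add: q_def)
    then have "x * x ^ (q - 1) = QF.bar x" by (simp flip: power_Suc q)
    then have z: "x ^ (q - 1) = QF.bar x / x" using False by (simp add: field_simps)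
    have "poly f x = QF.fr x * x * (a * QF.fr (x ^ (q - 1)) * x ^ (q - 1) + b * QF.fr (x ^ (q - 1)) + c * x ^ (q - 1) + d)"
      by (simp add: f_def A_def poly_monom poly_pcompose Q mult_ac)
    also have "\<dots> = QF.beta x x"
      unfolding z using False by (simp add: QF.beta_def field_simps)
    finally show ?thesis .
  qed
  have "permutation_poly f \<longleftrightarrow> inj (\<lambda>x. QF.beta x x)"
    unfolding permutation_poly_def bij_def f[abs_def] using finite_UNIV_inj_surj[OF finite, of "\<lambda>x. QF.beta x x"] by auto
  moreover have "QF.v ^ Q = e ^ (Q - 1) * QF.w \<longleftrightarrow> e * QF.fr QF.v = QF.fr e * QF.w" if "e \<noteq> 0"
  proof -
    have "e * e ^ (Q - 1) = QF.fr e" by (simp add: Q_def flip: power_Suc Q)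
    then have "QF.fr e * QF.w = e * (e ^ (Q - 1) * QF.w)" by (simp add: mult.assoc)
    then show ?thesis using that by (simp only: Q mult_cancel_left) simp
  qed
  ultimately show ?thesis unfolding QF.inj_iff v w \<tau> e[symmetric] by blast
qed

end
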